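(* A bitopological space is d-spectral if and only if it is homeomorphic (as a bitopological space) to the spectrum $(\operatorname{dSpec}\mathcal{L},\tau_+,\tau_-)$ of some d-lattice $\mathcal{L}$.
   Context: **Bitopological spaces.** A bitopological space is a triple $(X,\tau_+,\tau_-)$ with $X$ a set and $\tau_+,\tau_-$ topologies on $X$. A map between bitopological spaces is continuous if it is continuous for both the first topologies and the second topologies; a homeomorphism is an isomorphism for these maps. $(X,\tau_+,\tau_-)$ is compact if $(X,\tau_+\vee\tau_-)$ is compact, where $\tau_+\vee\tau_-$ is the join topology. An element $x$ of a poset is finite if for each directed subset $D$ having a join with $x\sqsubseteq\bigsqcup D$, one has $x\sqsubseteq d$ for some $d\in D$. A frame is coherent if every element is a join of finite elements, $1$ is finite, and the meet of two finite elements is finite. $(X,\tau_+,\tau_-)$ is d-sober if for every pair $(K_+,K_-)$, where $K_+$ is a (nonempty) irreducible closed set of $(X,\tau_+)$ and $K_-$ a (nonempty) irreducible closed set of $(X,\tau_-)$, such that for all $U\in\tau_+$, $V\in\tau_-$: (i) $U\cap V=\varnothing$ implies $K_+\cap U=\varnothing$ or $K_-\cap V=\varnothing$; (ii) $U\cup V=X$ implies $K_+\cap U\ne\varnothing$ or $K_-\cap V\neq\varnothing$; there is a unique $x\in X$ such that $K_+$ is the $\tau_+$-closure of $\{x\}$ and $K_-$ is the $\tau_-$-closure of $\{x\}$. $(X,\tau_+,\tau_-)$ is d-spectral if it is compact, d-sober, and both $\tau_+$ and $\tau_-$ are coherent frames. **d-lattices.** All distributive lattices are bounded with top $1$ and bottom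 $0$, and lattice homomorphisms preserve $0,1$. Let $(L,\sqsubseteq)$ be a distributive lattice and ${t\!t},{f\!\!f}\in L$ with ${t\!t}\sqcup{f\!\!f}=1$, ${t\!t}\sqcap{f\!\!f}=0$. Put $L_+=\{x: x\sqsubseteq {t\!t}\}$ and $L_-=\{x:x\sqsubseteq {f\!\!f}\}$; then $L\cong L_+\times L_-$ via $x\mapsto(x\sqcap{t\!t},x\sqcap{f\!\!f})$. The logic order on $L$ is: $x\leq y$ iff $x\sqcap{t\!t}\sqsubseteq y\sqcap{t\!t}$ and $x\sqcap{f\!\!f}\sqsupseteq y\sqcap{f\!\!f}$; $(L,\leq)$ is a distributive lattice with top ${t\!t}$, bottom ${f\!\!f}$. A d-lattice $\mathcal{L}=(L;{t\!t},{f\!\!f};{\bf con},{\bf tot})$ consists of such data with subsets ${\bf con},{\bf tot}\subseteq L$ such that: ${t\!t},{f\!\!f}\in{\bf con}\cap{\bf tot}$; ${\bf con}$ is a lower set and ${\bf tot}$ an upper set for $\sqsubseteq$; ${\bf con}$ and ${\bf tot}$ are sublattices of $(L,\leq)$; and if $\alpha\in{\bf con}$, $\beta\in{\bf tot}$ and ($\alpha\sqcap{t\!t}=\beta\sqcap{t\!t}$ or $\alpha\sqcap{f\!\!f}=\beta\sqcap{f\!\!f}$), then $\alpha\sqsubseteq\beta$. It is assumed that $\{{t\!t},{f\!\!f}\}\neq\{1,0\}$ unless $L$ is the one-element lattice. A d-lattice homomorphism is a lattice homomorphism sending ${t\!t},{f\!\!f}$ to ${t\!t},{f\!\!f}$ respectively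 and mapping ${\bf con}$ into ${\bf con}$ and ${\bf tot}$ into ${\bf tot}$. $\mathbb{B}$ is the four-element Boolean algebra $\{0,1,{t\!t},{f\!\!f}\}$ (${t\!t},{f\!\!f}$ complementary atoms) regarded as a d-lattice with ${\bf con}=\{0,{t\!t},{f\!\!f}\}$, ${\bf tot}=\{1,{t\!t},{f\!\!f}\}$. **Spectrum.** A prime d-filter of $\mathcal{L}$ is a d-lattice homomorphism $\mathcal{L}\to\mathbb{B}$; $\operatorname{dSpec}\mathcal{L}$ is the set of them. The spectrum of $\mathcal{L}$ is $(\operatorname{dSpec}\mathcal{L},\tau_+,\tau_-)$, where $\tau_+$ is generated by the sets $\phi_+(a)=\{g: g(a)={t\!t}\}$ ($a\in L_+$) and $\tau_-$ by the sets $\phi_-(b)=\{g:g(b)={f\!\!f}\}$ ($b\in L_-$). *)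

theory Defs
  imports "HOL-Analysis.Analysis" "HOL-Algebra.Complete_Lattice"
begin

text \<open>Orders and lattices are the carrier-based structures of \<open>HOL-Algebra\<close>. The theory names in
  qualified locale names separate these locales from the type classes of the same name.\<close>

section \<open>Coherent frames\<close>

definition directed_in :: "('a, 'm) gorder_scheme \<Rightarrow> 'a set \<Rightarrow> bool" where
  "directed_in P D \<longleftrightarrow> D \<subseteq> carrier P \<and> D \<noteq> {} \<and>
     (\<forall>x\<in>D. \<forall>y\<in>D. \<exists>z\<in>D. x \<sqsubseteq>\<^bsub>P\<^esub> z \<and> y \<sqsubseteq>\<^bsub>P\<^esub> z)"

definition finite_element :: "('a, 'm) gorder_scheme \<Rightarrow> 'a \<Rightarrow> bool" where
  "finite_element P x \<longleftrightarrow> x \<in> carrier P \<and>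
     (\<forall>D s. directed_in P D \<and> is_lub P s D \<and> x \<sqsubseteq>\<^bsub>P\<^esub> s \<longrightarrow> (\<exists>d\<in>D. x \<sqsubseteq>\<^bsub>P\<^esub> d))"

locale frame = Complete_Lattice.complete_lattice +
  assumes meet_sup_distrib:
    "\<lbrakk>x \<in> carrier L; A \<subseteq> carrier L\<rbrakk> \<Longrightarrow> x \<sqinter> \<Squnion>A = \<Squnion>((\<lambda>a. x \<sqinter> a) ` A)"

locale coherent_frame = frame +
  assumes join_of_finite:
      "x \<in> carrier L \<Longrightarrow> \<exists>A. A \<subseteq> {a. finite_element L a} \<and> is_lub L x A"
    and finite_top: "finite_element L \<top>"
    and finite_meet:
      "\<lbrakk>finite_element L x; finite_element L y\<rbrakk> \<Longrightarrow> finite_element L (x \<sqinter> y)"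

definition opens :: "'a topology \<Rightarrow> 'a set gorder" where
  "opens T = \<lparr>carrier = {U. openin T U}, eq = (=), le = (\<subseteq>)\<rparr>"

section \<open>Bitopological spaces\<close>

type_synonym 'a bitop = "'a topology \<times> 'a topology"

definition bitopological_space :: "'a bitop \<Rightarrow> bool" where
  "bitopological_space X \<longleftrightarrow> topspace (fst X) = topspace (snd X)"

definition bicontinuous_map :: "'a bitop \<Rightarrow> 'b bitop \<Rightarrow> ('a \<Rightarrow> 'b) \<Rightarrow> bool" where
  "bicontinuous_map X Y f \<longleftrightarrow>
     continuous_map (fst X) (fst Y) f \<and> continuous_map (snd X) (snd Y) f"

definition bihomeomorphic :: "'a bitop \<Rightarrow> 'b bitop \<Rightarrow> bool" where
  "bihomeomorphic X Y \<longleftrightarrow> (\<exists>f g. bicontinuous_map X Y f \<and> bicontinuous_map Y X g \<and>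
     (\<forall>x\<in>topspace (fst X). g (f x) = x) \<and> (\<forall>y\<in>topspace (fst Y). f (g y) = y))"

definition join_topology :: "'a bitop \<Rightarrow> 'a topology" where
  "join_topology X = topology_generated_by ({U. openin (fst X) U} \<union> {V. openin (snd X) V})"

definition bicompact :: "'a bitop \<Rightarrow> bool" where
  "bicompact X \<longleftrightarrow> compact_space (join_topology X)"

definition irreducible_closedin :: "'a topology \<Rightarrow> 'a set \<Rightarrow> bool" where
  "irreducible_closedin T K \<longleftrightarrow> closedin T K \<and> K \<noteq> {} \<and>
     (\<forall>A B. closedin T A \<and> closedin T B \<and> K = A \<union> B \<longrightarrow> K = A \<or> K = B)"

definition d_sober :: "'a bitop \<Rightarrow> bool" where
  "d_sober X \<longleftrightarrow>
     (\<forall>Kp Km. irreducible_closedin (fst X) Kp \<and> irreducible_closedin (snd X) Km \<and>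
        (\<forall>U V. openin (fst X) U \<and> openin (snd X) V \<longrightarrow>
           (U \<inter> V = {} \<longrightarrow> Kp \<inter> U = {} \<or> Km \<inter> V = {}) \<and>
           (U \<union> V = topspace (fst X) \<longrightarrow> Kp \<inter> U \<noteq> {} \<or> Km \<inter> V \<noteq> {})) \<longrightarrow>
        (\<exists>!x. x \<in> topspace (fst X) \<and>
           Kp = (fst X) closure_of {x} \<and> Km = (snd X) closure_of {x}))"

definition d_spectral :: "'a bitop \<Rightarrow> bool" where
  "d_spectral X \<longleftrightarrow> bitopological_space X \<and> bicompact X \<and> d_sober X \<and>
     coherent_frame (opens (fst X)) \<and> coherent_frame (opens (snd X))"

section \<open>d-lattices\<close>

locale distributive_bounded_lattice = Lattice.bounded_lattice +
  assumes meet_join_distrib: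
    "\<lbrakk>x \<in> carrier L; y \<in> carrier L; z \<in> carrier L\<rbrakk> \<Longrightarrow> x \<sqinter> (y \<squnion> z) = (x \<sqinter> y) \<squnion> (x \<sqinter> z)"

record 'a dlattice = "'a gorder" +
  tt :: 'a
  ff :: 'a
  con :: "'a set"
  tot :: "'a set"

definition logic_order :: "('a, 'm) dlattice_scheme \<Rightarrow> 'a gorder" where
  "logic_order L = \<lparr>carrier = carrier L, eq = (=),
     le = (\<lambda>x y. x \<sqinter>\<^bsub>L\<^esub> tt L \<sqsubseteq>\<^bsub>L\<^esub> y \<sqinter>\<^bsub>L\<^esub> tt L \<and> y \<sqinter>\<^bsub>L\<^esub> ff L \<sqsubseteq>\<^bsub>L\<^esub> x \<sqinter>\<^bsub>L\<^esub> ff L)\<rparr>"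

definition sublattice :: "'a set \<Rightarrow> ('a, 'm) gorder_scheme \<Rightarrow> bool" where
  "sublattice S P \<longleftrightarrow> S \<subseteq> carrier P \<and>
     (\<forall>x\<in>S. \<forall>y\<in>S. x \<squnion>\<^bsub>P\<^esub> y \<in> S \<and> x \<sqinter>\<^bsub>P\<^esub> y \<in> S)"

locale d_lattice = distributive_bounded_lattice L
  for L :: "('a, 'm) dlattice_scheme" (structure) +
  assumes tt_closed: "tt L \<in> carrier L"
    and ff_closed: "ff L \<in> carrier L"
    and tt_join_ff: "tt L \<squnion> ff L = \<top>"
    and tt_meet_ff: "tt L \<sqinter> ff L = \<bottom>"
    and con_subset: "con L \<subseteq> carrier L"
    and tot_subset: "tot L \<subseteq> carrier L"
    and tt_ff_con: "tt L \<in> con L" "ff L \<in> con L"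
    and tt_ff_tot: "tt L \<in> tot L" "ff L \<in> tot L"
    and con_lower: "\<lbrakk>x \<in> carrier L; y \<in> con L; x \<sqsubseteq> y\<rbrakk> \<Longrightarrow> x \<in> con L"
    and tot_upper: "\<lbrakk>x \<in> tot L; y \<in> carrier L; x \<sqsubseteq> y\<rbrakk> \<Longrightarrow> y \<in> tot L"
    and con_sublattice: "sublattice (con L) (logic_order L)"
    and tot_sublattice: "sublattice (tot L) (logic_order L)"
    and con_tot: "\<lbrakk>a \<in> con L; b \<in> tot L;
        a \<sqinter> tt L = b \<sqinter> tt L \<or> a \<sqinter> ff L = b \<sqinter> ff L\<rbrakk> \<Longrightarrow> a \<sqsubseteq> b"
    and nondegenerate: "{tt L, ff L} = {\<top>, \<bottom>} \<Longrightarrow> \<exists>x. carrier L = {x}"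

definition d_lattice_hom ::
    "('a, 'm) dlattice_scheme \<Rightarrow> ('b, 'n) dlattice_scheme \<Rightarrow> ('a \<Rightarrow> 'b) \<Rightarrow> bool" where
  "d_lattice_hom L M f \<longleftrightarrow> f \<in> carrier L \<rightarrow> carrier M \<and>
     join_pres L M f \<and> meet_pres L M f \<and> f \<top>\<^bsub>L\<^esub> = \<top>\<^bsub>M\<^esub> \<and> f \<bottom>\<^bsub>L\<^esub> = \<bottom>\<^bsub>M\<^esub> \<and>
     f (tt L) = tt M \<and> f (ff L) = ff M \<and> f ` con L \<subseteq> con M \<and> f ` tot L \<subseteq> tot M"

text \<open>The Boolean d-lattice with complementary atoms \<open>tt\<close> and \<open>ff\<close>; its bottom and top are
  \<open>(False, False)\<close> and \<open>(True, True)\<close>.\<close>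

definition four :: "(bool \<times> bool) dlattice" where
  "four = \<lparr>carrier = UNIV, eq = (=), le = (\<lambda>x y. fst x \<le> fst y \<and> snd x \<le> snd y),
     tt = (True, False), ff = (False, True),
     con = {(False, False), (True, False), (False, True)},
     tot = {(True, True), (True, False), (False, True)}\<rparr>"

section \<open>The spectrum\<close>

text \<open>Extensionality makes a homomorphism determined by its values on the carrier, so that
  equality of points is equality of homomorphisms.\<close>

definition dSpec :: "('a, 'm) dlattice_scheme \<Rightarrow> ('a \<Rightarrow> bool \<times> bool) set" where
  "dSpec L = {g \<in> extensional (carrier L). d_lattice_hom L four g}"

definition phi_pos :: "('a, 'm) dlattice_scheme \<Rightarrow> 'a \<Rightarrow> ('a \<Rightarrow> bool \<times> bool) set" where
  "phi_pos L a = {g \<in> dSpec L. g a = tt four}"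

definition phi_neg :: "('a, 'm) dlattice_scheme \<Rightarrow> 'a \<Rightarrow> ('a \<Rightarrow> bool \<times> bool) set" where
  "phi_neg L b = {g \<in> dSpec L. g b = ff four}"

text \<open>The underlying set of a generated topology is the union of the generators; here it is
  \<open>dSpec L\<close>, which equals both \<open>phi_pos L (tt L)\<close> and \<open>phi_neg L (ff L)\<close>.\<close>

definition d_spectrum :: "('a, 'm) dlattice_scheme \<Rightarrow> ('a \<Rightarrow> bool \<times> bool) bitop" where
  "d_spectrum L =
     (topology_generated_by (phi_pos L ` {a \<in> carrier L. a \<sqsubseteq>\<^bsub>L\<^esub> tt L}),
      topology_generated_by (phi_neg L ` {b \<in> carrier L. b \<sqsubseteq>\<^bsub>L\<^esub> ff L}))"

end

theory Submission
  imports Defs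
begin

text \<open>The finite elements of a frame of open sets are the compact open sets.

  Homomorphisms into \<open>four\<close> form a closed subset of a power of a finite discrete space, and the
  sets \<open>phi_pos L a\<close> and \<open>phi_neg L b\<close> are clopen there; this gives compactness and coherence of
  the spectrum. A pair of irreducible closed sets as in the definition of d-sobriety yields the
  homomorphism recording which basic open sets they meet, conditions (i) and (ii) being preservation
  of \<open>con\<close> and \<open>tot\<close>.

  Conversely, for a d-spectral space take the pairs \<open>(U, V)\<close> of a compact open set of the first and
  one of the second topology, \<open>con\<close> being disjointness and \<open>tot\<close> covering. A homomorphism into
  \<open>four\<close> is a pair of prime filters of compact open sets, hence a pair of irreducible closed sets.
  It satisfies (i) by coherence and (ii) by compactness of the join topology, so d-sobriety provides
  the point that it comes from.\<close>

text \<open>Both directions rest on one dictionary. A closed set is determined by the basic open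
  sets that it meets; for a nonempty closed set, irreducibility says exactly that the open sets met
  by it are closed under intersection; and over an intersection-stable base of compact open sets
  every prime filter comes from an irreducible closed set. Statements about irreducible closed sets
  thus become statements about which basic sets are met.

  The homomorphisms form a closed subset of the power because each requirement on a homomorphism
  involves at most three of its values. The topology induced there, the patch topology, refines both
  topologies of the spectrum and also their join, so one compactness argument serves all three.

  The obstacle in the converse direction is that (i) and (ii) speak of arbitrary open sets, whereas
  a homomorphism only sees compact open ones. Shrinking two disjoint open sets around chosen points
  is local; shrinking a cover of the whole space to a compact open cover is not, and this is what
  the join topology has to provide.\<close>

section \<open>Joins, meets, top and bottom computed from the order\<close>

lemma is_lub_pairI:
  assumes "x \<in> carrier P" "y \<in> carrier P" "s \<in> carrier P" "x \<sqsubseteq>\<^bsub>P\<^esub> s" "y \<sqsubseteq>\<^bsub>P\<^esub> s"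
    and "\<And>z. \<lbrakk>z \<in> carrier P; x \<sqsubseteq>\<^bsub>P\<^esub> z; y \<sqsubseteq>\<^bsub>P\<^esub> z\<rbrakk> \<Longrightarrow> s \<sqsubseteq>\<^bsub>P\<^esub> z"
  shows "is_lub P s {x, y}"
  using assms by (auto simp: least_def Upper_def)

lemma is_glb_pairI:
  assumes "x \<in> carrier P" "y \<in> carrier P" "s \<in> carrier P" "s \<sqsubseteq>\<^bsub>P\<^esub> x" "s \<sqsubseteq>\<^bsub>P\<^esub> y"
    and "\<And>z. \<lbrakk>z \<in> carrier P; z \<sqsubseteq>\<^bsub>P\<^esub> x; z \<sqsubseteq>\<^bsub>P\<^esub> y\<rbrakk> \<Longrightarrow> z \<sqsubseteq>\<^bsub>P\<^esub> s"
  shows "is_glb P s {x, y}"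
  using assms by (auto simp: greatest_def Lower_def)

text \<open>\<open>join\<close> selects some least upper bound by \<open>SOME\<close>, so evaluating
  it takes uniqueness. The premise \<open>antisym\<close> asks for this at \<open>s\<close> alone,
  so that the rule applies to structures such as \<open>four\<close>, \<open>opens T\<close> or
  \<open>logic_order L\<close> before they are known to be partial orders. The three rules that
  follow have the same form.\<close>

lemma join_eqI:
  assumes "x \<in> carrier P" "y \<in> carrier P" "s \<in> carrier P" "x \<sqsubseteq>\<^bsub>P\<^esub> s" "y \<sqsubseteq>\<^bsub>P\<^esub> s"
    and least: "\<And>z. \<lbrakk>z \<in> carrier P; x \<sqsubseteq>\<^bsub>P\<^esub> z; y \<sqsubseteq>\<^bsub>P\<^esub> z\<rbrakk> \<Longrightarrow> s \<sqsubseteq>\<^bsub>P\<^esub> z"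
    and antisym: "\<And>z. \<lbrakk>z \<in> carrier P; s \<sqsubseteq>\<^bsub>P\<^esub> z; z \<sqsubseteq>\<^bsub>P\<^esub> s\<rbrakk> \<Longrightarrow> z = s"
  shows "x \<squnion>\<^bsub>P\<^esub> y = s"
  unfolding join_def sup_def
proof (rule some_equality)
  show "is_lub P s {x, y}" by (rule is_lub_pairI) (use assms in blast)+
  show "z = s" if "is_lub P z {x, y}" for z
    using that assms by (auto simp: least_def Upper_def)
qed

lemma meet_eqI:
  assumes "x \<in> carrier P" "y \<in> carrier P" "s \<in> carrier P" "s \<sqsubseteq>\<^bsub>P\<^esub> x" "s \<sqsubseteq>\<^bsub>P\<^esub> y"
    and greatest: "\<And>z. \<lbrakk>z \<in> carrier P; z \<sqsubseteq>\<^bsub>P\<^esub> x; z \<sqsubseteq>\<^bsub>P\<^esub> y\<rbrakk> \<Longrightarrow> z \<sqsubseteq>\<^bsub>P\<^esub> s"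
    and antisym: "\<And>z. \<lbrakk>z \<in> carrier P; s \<sqsubseteq>\<^bsub>P\<^esub> z; z \<sqsubseteq>\<^bsub>P\<^esub> s\<rbrakk> \<Longrightarrow> z = s"
  shows "x \<sqinter>\<^bsub>P\<^esub> y = s"
  unfolding meet_def inf_def
proof (rule some_equality)
  show "is_glb P s {x, y}" by (rule is_glb_pairI) (use assms in blast)+
  show "z = s" if "is_glb P z {x, y}" for z
    using that assms by (auto simp: greatest_def Lower_def)
qed

lemma top_eqI:
  assumes "t \<in> carrier P" "\<And>z. z \<in> carrier P \<Longrightarrow> z \<sqsubseteq>\<^bsub>P\<^esub> t"
    and "\<And>z. \<lbrakk>z \<in> carrier P; t \<sqsubseteq>\<^bsub>P\<^esub> z\<rbrakk> \<Longrightarrow> z = t"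
  shows "\<top>\<^bsub>P\<^esub> = t"
  unfolding top_def by (rule some_equality) (use assms in \<open>auto simp: greatest_def\<close>)

lemma bottom_eqI:
  assumes "b \<in> carrier P" "\<And>z. z \<in> carrier P \<Longrightarrow> b \<sqsubseteq>\<^bsub>P\<^esub> z"
    and "\<And>z. \<lbrakk>z \<in> carrier P; z \<sqsubseteq>\<^bsub>P\<^esub> b\<rbrakk> \<Longrightarrow> z = b"
  shows "\<bottom>\<^bsub>P\<^esub> = b"
  unfolding bottom_def by (rule some_equality) (use assms in \<open>auto simp: least_def\<close>)

section \<open>Coherence in topological terms\<close>

definition compact_openin :: "'a topology \<Rightarrow> 'a set \<Rightarrow> bool" where
  "compact_openin T U \<longleftrightarrow> openin T U \<and> compactin T U"

text \<open>A spectral space without the sobriety axiom. This is what coherence of the frame of open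
  sets says about the space itself; sobriety is replaced by d-sobriety, which concerns both
  topologies together.\<close>

definition coherent_space :: "'a topology \<Rightarrow> bool" where
  "coherent_space T \<longleftrightarrow> compact_space T \<and>
     (\<forall>U x. openin T U \<and> x \<in> U \<longrightarrow> (\<exists>C. compact_openin T C \<and> x \<in> C \<and> C \<subseteq> U)) \<and>
     (\<forall>C D. compact_openin T C \<and> compact_openin T D \<longrightarrow> compact_openin T (C \<inter> D))"

lemma opens_simps [simp]:
  "carrier (opens T) = {U. openin T U}" "(\<sqsubseteq>\<^bsub>opens T\<^esub>) = (\<subseteq>)" "(.=\<^bsub>opens T\<^esub>) = (=)"
  by (simp_all add: opens_def)

lemma is_lub_opens_iff:
  assumes "A \<subseteq> {U. openin T U}"
  shows "is_lub (opens T) s A \<longleftrightarrow> s = \<Union>A"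
proof
  have "openin T (\<Union>A)" using assms by blast
  moreover assume "is_lub (opens T) s A"
  ultimately have "s \<subseteq> \<Union>A" "\<Union>A \<subseteq> s"
    using assms by (auto simp: least_def Upper_def)
  then show "s = \<Union>A" by blast
next
  show "s = \<Union>A \<Longrightarrow> is_lub (opens T) s A"
    using assms by (auto simp: least_def Upper_def)
qed

lemma Sup_opens:
  assumes "A \<subseteq> {U. openin T U}"
  shows "\<Squnion>\<^bsub>opens T\<^esub>A = \<Union>A"
  unfolding sup_def using is_lub_opens_iff[OF assms] by simp

lemma meet_opens:
  "\<lbrakk>openin T U; openin T V\<rbrakk> \<Longrightarrow> U \<sqinter>\<^bsub>opens T\<^esub> V = U \<inter> V"
  by (rule meet_eqI) auto

lemma partial_order_opens: "partial_order (opens T)"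
  by unfold_locales auto

lemma complete_lattice_opens: "Complete_Lattice.complete_lattice (opens T)"
proof -
  interpret partial_order "opens T" by (rule partial_order_opens)
  show ?thesis
  proof
    show "\<exists>s. is_lub (opens T) s A" if "A \<subseteq> carrier (opens T)" for A
      using that by (auto simp: is_lub_opens_iff)
    show "\<exists>i. is_glb (opens T) i A" if "A \<subseteq> carrier (opens T)" for A
    proof
      \<comment> \<open>The interior of the intersection of \<open>A\<close>, written as a union so
        that empty \<open>A\<close> yields the whole space.\<close>
      show "is_glb (opens T) (\<Union>{U. openin T U \<and> (\<forall>V\<in>A. U \<subseteq> V)}) A"
        using that by (auto simp: greatest_def Lower_def)
    qed
  qed
qed

lemma top_opens: "\<top>\<^bsub>opens T\<^esub> = topspace T"
  by (rule top_eqI) (auto dest: openin_subset)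

lemma frame_opens: "frame (opens T)"
proof (intro frame.intro frame_axioms.intro complete_lattice_opens)
  fix U A assume "U \<in> carrier (opens T)" and A: "A \<subseteq> carrier (opens T)"
  then have "(\<lambda>V. U \<sqinter>\<^bsub>opens T\<^esub> V) ` A = (\<lambda>V. U \<inter> V) ` A"
    by (intro image_cong) (auto simp: meet_opens)
  moreover have "U \<sqinter>\<^bsub>opens T\<^esub> \<Squnion>\<^bsub>opens T\<^esub>A = U \<inter> \<Union>A"
    using \<open>U \<in> _\<close> A by (subst Sup_opens) (auto intro!: meet_opens)
  moreover have "\<Squnion>\<^bsub>opens T\<^esub>((\<inter>) U ` A) = U \<inter> \<Union>A"
    using \<open>U \<in> _\<close> A by (subst Sup_opens) auto
  ultimately show "U \<sqinter>\<^bsub>opens T\<^esub> \<Squnion>\<^bsub>opens T\<^esub>A = \<Squnion>\<^bsub>opens T\<^esub>((\<lambda>V. U \<sqinter>\<^bsub>opens T\<^esub> V) ` A)"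
    by simp
qed

text \<open>The unions of finite subfamilies of a cover form a directed family with the same join,
  so a finite element lies below one of them, which is a finite subcover. Conversely, a finite
  subcover taken from a directed family is dominated by a single member of that family.\<close>

lemma finite_element_opens_iff: "finite_element (opens T) U \<longleftrightarrow> compact_openin T U"
proof
  assume fin: "finite_element (opens T) U"
  then have U: "openin T U" by (simp add: finite_element_def)
  have "\<exists>\<F>. finite \<F> \<and> \<F> \<subseteq> \<U> \<and> U \<subseteq> \<Union>\<F>"
    if \<U>: "\<forall>V\<in>\<U>. openin T V" and cover: "U \<subseteq> \<Union>\<U>" for \<U>
  proof -
    define D where "D = Union ` {\<F>. finite \<F> \<and> \<F> \<subseteq> \<U>}"
    have "directed_in (opens T) D"
      unfolding directed_in_def
    proof (intro conjI ballI)
      show "D \<noteq> {}" by (auto simp: D_def)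
      show "D \<subseteq> carrier (opens T)" using \<U> by (auto simp: D_def)
      fix x y assume "x \<in> D" "y \<in> D"
      then obtain \<F> \<G> where "x = \<Union>\<F>" "y = \<Union>\<G>" "finite (\<F> \<union> \<G>)" "\<F> \<union> \<G> \<subseteq> \<U>"
        by (auto simp: D_def)
      then have "\<Union>(\<F> \<union> \<G>) \<in> D" "x \<subseteq> \<Union>(\<F> \<union> \<G>)" "y \<subseteq> \<Union>(\<F> \<union> \<G>)"
        unfolding D_def by blast+
      then show "\<exists>z\<in>D. x \<sqsubseteq>\<^bsub>opens T\<^esub> z \<and> y \<sqsubseteq>\<^bsub>opens T\<^esub> z" by auto
    qed
    moreover from this have "is_lub (opens T) (\<Union>D) D"
      by (simp add: is_lub_opens_iff directed_in_def)
    moreover have "U \<sqsubseteq>\<^bsub>opens T\<^esub> \<Union>D"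
    proof -
      have "{V} \<in> {\<F>. finite \<F> \<and> \<F> \<subseteq> \<U>}" if "V \<in> \<U>" for V using that by simp
      then have "\<Union>\<U> \<subseteq> \<Union>D" unfolding D_def by blast
      then show ?thesis using cover by auto
    qed
    ultimately obtain d where "d \<in> D" "U \<subseteq> d"
      using fin unfolding finite_element_def opens_simps by meson
    then show ?thesis by (auto simp: D_def)
  qed
  then show "compact_openin T U"
    using U by (auto simp: compact_openin_def compactin_def dest: openin_subset)
next
  assume U: "compact_openin T U"
  show "finite_element (opens T) U"
    unfolding finite_element_def
  proof (intro conjI allI impI)
    show "U \<in> carrier (opens T)" using U by (simp add: compact_openin_def)
    fix D s assume D: "directed_in (opens T) D \<and> is_lub (opens T) s D \<and> U \<sqsubseteq>\<^bsub>opens T\<^esub> s"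
    then have op: "\<forall>V\<in>D. openin T V" by (auto simp: directed_in_def)
    moreover have "U \<subseteq> \<Union>D" using D op is_lub_opens_iff[of D T s] by auto
    ultimately obtain \<F> where \<F>: "finite \<F>" "\<F> \<subseteq> D" "U \<subseteq> \<Union>\<F>"
      using U unfolding compact_openin_def compactin_def by meson
    have "\<exists>d\<in>D. \<Union>\<F> \<subseteq> d" using \<F>(1,2)
    proof (induction rule: finite_induct)
      case empty
      then show ?case using D by (auto simp: directed_in_def)
    next
      case (insert V \<F>)
      then obtain d where "d \<in> D" "\<Union>\<F> \<subseteq> d" "V \<in> D" by auto
      moreover from this obtain z where "z \<in> D" "d \<subseteq> z" "V \<subseteq> z"
        using D unfolding directed_in_def opens_simps by blast
      ultimately show ?case by (intro bexI[of _ z]) auto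
    qed
    then show "\<exists>d\<in>D. U \<sqsubseteq>\<^bsub>opens T\<^esub> d" using \<F>(3) by auto
  qed
qed

text \<open>If an open set is a join of finite elements at all, it is the union of all compact open
  sets inside it. The existence of a suitable family can therefore be replaced by the pointwise
  condition that compact open sets form a base.\<close>

lemma coherent_frame_opens_iff: "coherent_frame (opens T) \<longleftrightarrow> coherent_space T"
proof -
  have "(\<forall>U. openin T U \<longrightarrow> (\<exists>A. A \<subseteq> Collect (compact_openin T) \<and> is_lub (opens T) U A)) \<longleftrightarrow>
    (\<forall>U x. openin T U \<and> x \<in> U \<longrightarrow> (\<exists>C. compact_openin T C \<and> x \<in> C \<and> C \<subseteq> U))"
    (is "?l \<longleftrightarrow> ?r")
  proof
    have lub: "A \<subseteq> Collect (compact_openin T) \<Longrightarrow> is_lub (opens T) U A \<longleftrightarrow> U = \<Union>A" for U A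
      by (rule is_lub_opens_iff) (auto simp: compact_openin_def)
    show ?r if l: ?l
    proof (intro allI impI)
      fix U x assume U: "openin T U \<and> x \<in> U"
      with l have "\<exists>A. A \<subseteq> Collect (compact_openin T) \<and> is_lub (opens T) U A" by simp
      then obtain A where A: "A \<subseteq> Collect (compact_openin T)" "is_lub (opens T) U A"
        by (elim exE conjE)
      with lub have "U = \<Union>A" by simp
      with U A(1) show "\<exists>C. compact_openin T C \<and> x \<in> C \<and> C \<subseteq> U" by blast
    qed
    show ?l if r: ?r
    proof (intro allI impI)
      fix U assume "openin T U"
      then have "U = \<Union>{C. compact_openin T C \<and> C \<subseteq> U}" using r by blast
      moreover have "{C. compact_openin T C \<and> C \<subseteq> U} \<subseteq> Collect (compact_openin T)" by auto
      ultimately show "\<exists>A. A \<subseteq> Collect (compact_openin T) \<and> is_lub (opens T) U A"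
        using lub by metis
    qed
  qed
  moreover have "C \<sqinter>\<^bsub>opens T\<^esub> D = C \<inter> D" if "compact_openin T C" "compact_openin T D" for C D
    using that by (auto simp: compact_openin_def meet_opens)
  ultimately show ?thesis
    unfolding coherent_frame_def coherent_frame_axioms_def coherent_space_def
      finite_element_opens_iff top_opens compact_space_def
    using frame_opens[of T] by (auto simp: compact_openin_def[of _ "topspace T"])
qed

section \<open>Bases of generated topologies\<close>

text \<open>A generated topology arises from binary intersections and arbitrary unions, with the
  union of the generators as whole space, so the empty intersection never has to be matched by a
  generator.\<close>

lemma openin_generated_base:
  assumes Int: "\<And>b c. \<lbrakk>b \<in> B; c \<in> B\<rbrakk> \<Longrightarrow> b \<inter> c \<in> B"
    and "openin (topology_generated_by B) U" "x \<in> U"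
  shows "\<exists>b\<in>B. x \<in> b \<and> b \<subseteq> U"
proof -
  have "generate_topology_on B U"
    using assms(2) by (rule openin_topology_generated_by)
  then show ?thesis using \<open>x \<in> U\<close>
  proof (induction arbitrary: x rule: generate_topology_on.induct)
    case (Int U V)
    then obtain b c where "b \<in> B" "x \<in> b" "b \<subseteq> U" "c \<in> B" "x \<in> c" "c \<subseteq> V" by blast
    then show ?case using assms(1) by (intro bexI[of _ "b \<inter> c"]) auto
  next
    case (UN K)
    then obtain k where "k \<in> K" "x \<in> k" by blast
    with UN.IH obtain b where "b \<in> B" "x \<in> b" "b \<subseteq> k" by blast
    with \<open>k \<in> K\<close> show ?case by blast
  qed auto
qed

text \<open>By compactness, a compact open set is a finite union of members of \<open>B\<close>. The
  intersection of two such unions is a finite union of intersections of members, and these are again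
  compact members of \<open>B\<close>.\<close>

lemma coherent_generated:
  assumes Int: "\<And>b c. \<lbrakk>b \<in> B; c \<in> B\<rbrakk> \<Longrightarrow> b \<inter> c \<in> B"
    and comp: "\<And>b. b \<in> B \<Longrightarrow> compactin (topology_generated_by B) b"
    and top: "\<Union>B \<in> B"
  shows "coherent_space (topology_generated_by B)" (is "coherent_space ?T")
proof -
  have base: "compact_openin ?T b" if "b \<in> B" for b
    using that comp by (simp add: compact_openin_def topology_generated_by_Basis)
  have Union: "\<exists>\<F>. finite \<F> \<and> \<F> \<subseteq> B \<and> C = \<Union>\<F>" if C: "compact_openin ?T C" for C
  proof -
    let ?\<U> = "{b \<in> B. b \<subseteq> C}"
    have "C \<subseteq> \<Union>?\<U>"
      using C openin_generated_base[OF Int] by (force simp: compact_openin_def)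
    moreover have "\<forall>U\<in>?\<U>. openin ?T U" by (simp add: topology_generated_by_Basis)
    ultimately obtain \<F> where "finite \<F>" "\<F> \<subseteq> ?\<U>" "C \<subseteq> \<Union>\<F>"
      using C unfolding compact_openin_def compactin_def by meson
    then have "C = \<Union>\<F>" "\<F> \<subseteq> B" by auto
    with \<open>finite \<F>\<close> show ?thesis by blast
  qed
  have "compact_openin ?T (C \<inter> D)" if C: "compact_openin ?T C" and D: "compact_openin ?T D" for C D
  proof -
    obtain \<F> \<G> where \<F>: "finite \<F>" "\<F> \<subseteq> B" "C = \<Union>\<F>" and \<G>: "finite \<G>" "\<G> \<subseteq> B" "D = \<Union>\<G>"
      using Union[OF C] Union[OF D] by blast
    have "C \<inter> D = \<Union>((\<lambda>(b, c). b \<inter> c) ` (\<F> \<times> \<G>))" using \<F> \<G> by auto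
    moreover have "compactin ?T (\<Union>((\<lambda>(b, c). b \<inter> c) ` (\<F> \<times> \<G>)))"
      using \<F> \<G> Int by (intro compactin_Union) (auto intro!: comp)
    moreover have "openin ?T (C \<inter> D)" using C D by (auto simp: compact_openin_def)
    ultimately show ?thesis by (simp add: compact_openin_def)
  qed
  moreover have "compact_space ?T"
    using comp[OF top] by (simp add: compact_space_def)
  moreover have "\<exists>C. compact_openin ?T C \<and> x \<in> C \<and> C \<subseteq> U" if "openin ?T U" "x \<in> U" for U x
    using openin_generated_base[OF Int that] base by blast
  ultimately show ?thesis unfolding coherent_space_def by blast
qed

section \<open>Irreducible closed sets\<close>

text \<open>If the intersection were missed, \<open>K - U\<close> and \<open>K - V\<close> would be
  two proper closed subsets covering \<open>K\<close>. Any set meets a union iff it meets one of the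
  parts; together with this lemma, the open sets that meet \<open>K\<close> form a prime
  filter.\<close>

lemma irreducible_closedin_Int:
  assumes "irreducible_closedin T K" "openin T U" "openin T V" "K \<inter> U \<noteq> {}" "K \<inter> V \<noteq> {}"
  shows "K \<inter> (U \<inter> V) \<noteq> {}"
proof
  assume "K \<inter> (U \<inter> V) = {}"
  then have "K = (K - U) \<union> (K - V)" by blast
  moreover have "closedin T (K - U)" "closedin T (K - V)"
    using assms by (auto simp: irreducible_closedin_def intro: closedin_diff)
  ultimately have "K = K - U \<or> K = K - V"
    using assms(1) unfolding irreducible_closedin_def by blast
  then show False using assms by blast
qed

lemma irreducible_closedin_closure_of_singleton:
  assumes "x \<in> topspace T"
  shows "irreducible_closedin T (T closure_of {x})"
  unfolding irreducible_closedin_def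
proof (intro conjI allI impI)
  show "closedin T (T closure_of {x})" by simp
  have x: "x \<in> T closure_of {x}" using assms by (auto simp: in_closure_of)
  then show "T closure_of {x} \<noteq> {}" by blast
  fix A B assume AB: "closedin T A \<and> closedin T B \<and> T closure_of {x} = A \<union> B"
  with x have "x \<in> A \<or> x \<in> B" by blast
  then have "T closure_of {x} \<subseteq> A \<or> T closure_of {x} \<subseteq> B"
    using AB by (meson closure_of_minimal empty_subsetI insert_subset)
  then show "T closure_of {x} = A \<or> T closure_of {x} = B" using AB by blast
qed

lemma closure_of_singleton_Int_open:
  assumes "openin T U" "x \<in> topspace T"
  shows "T closure_of {x} \<inter> U \<noteq> {} \<longleftrightarrow> x \<in> U"
  using assms openin_Int_closure_of_eq_empty[of T U "{x}"] by auto

section \<open>The spectrum of a d-lattice is d-spectral\<close>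

lemma four_simps [simp]:
  "carrier four = UNIV" "(.=\<^bsub>four\<^esub>) = (=)" "(\<sqsubseteq>\<^bsub>four\<^esub>) = (\<lambda>x y. (fst x \<longrightarrow> fst y) \<and> (snd x \<longrightarrow> snd y))"
  "tt four = (True, False)" "ff four = (False, True)"
  "con four = - {(True, True)}" "tot four = - {(False, False)}"
  by (auto simp: four_def)

lemma join_four: "x \<squnion>\<^bsub>four\<^esub> y = (fst x \<or> fst y, snd x \<or> snd y)"
  by (rule join_eqI) (unfold four_simps prod_eq_iff fst_conv snd_conv, blast+)

lemma meet_four: "x \<sqinter>\<^bsub>four\<^esub> y = (fst x \<and> fst y, snd x \<and> snd y)"
  by (rule meet_eqI) (unfold four_simps prod_eq_iff fst_conv snd_conv, blast+)

lemma top_four: "\<top>\<^bsub>four\<^esub> = (True, True)"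
  by (rule top_eqI) (unfold four_simps prod_eq_iff fst_conv snd_conv, blast+)

lemma bottom_four: "\<bottom>\<^bsub>four\<^esub> = (False, False)"
  by (rule bottom_eqI) (unfold four_simps prod_eq_iff fst_conv snd_conv, blast+)

text \<open>\<open>join_pres\<close> and \<open>meet_pres\<close> include the requirement that
  source and target are lattices.\<close>

lemma lattice_four: "Lattice.lattice four"
proof -
  interpret partial_order four
    by unfold_locales (unfold four_simps prod_eq_iff fun_eq_iff, blast+)
  show ?thesis
  proof
    show "\<exists>s. is_lub four s {x, y}" for x y
      by (rule exI[of _ "(fst x \<or> fst y, snd x \<or> snd y)"], rule is_lub_pairI) simp_all
    show "\<exists>s. is_glb four s {x, y}" for x y
      by (rule exI[of _ "(fst x \<and> fst y, snd x \<and> snd y)"], rule is_glb_pairI) simp_all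
  qed
qed

text \<open>With \<open>fst (g x)\<close> in place of \<open>g x = tt\<close> the argument may range over the whole lattice:
  \<open>pos_set L x\<close> is \<open>phi_pos L (x \<sqinter> tt L)\<close>, so both families have the same members.\<close>

definition pos_set :: "('a, 'm) dlattice_scheme \<Rightarrow> 'a \<Rightarrow> ('a \<Rightarrow> bool \<times> bool) set" where
  "pos_set L x = {g \<in> dSpec L. fst (g x)}"

definition neg_set :: "('a, 'm) dlattice_scheme \<Rightarrow> 'a \<Rightarrow> ('a \<Rightarrow> bool \<times> bool) set" where
  "neg_set L x = {g \<in> dSpec L. snd (g x)}"

context d_lattice
begin

lemma lattice_L: "Lattice.lattice L" ..

text \<open>Top and bottom are the join and the meet of \<open>tt L\<close> and \<open>ff L\<close>,
  so their images are fixed by the values at these two elements. Every clause on the values of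
  \<open>g\<close> reads at most three of them, which is the form that \<open>closedin_dSpec\<close>
  exploits.\<close>

lemma dSpec_iff:
  "g \<in> dSpec L \<longleftrightarrow> g \<in> extensional (carrier L) \<and>
    (\<forall>x\<in>carrier L. \<forall>y\<in>carrier L. g (x \<squnion> y) = (fst (g x) \<or> fst (g y), snd (g x) \<or> snd (g y))) \<and>
    (\<forall>x\<in>carrier L. \<forall>y\<in>carrier L. g (x \<sqinter> y) = (fst (g x) \<and> fst (g y), snd (g x) \<and> snd (g y))) \<and>
    g (tt L) = (True, False) \<and> g (ff L) = (False, True) \<and>
    (\<forall>x\<in>con L. g x \<noteq> (True, True)) \<and> (\<forall>x\<in>tot L. g x \<noteq> (False, False))"
    (is "_ \<longleftrightarrow> ?e \<and> ?J \<and> ?M \<and> ?t \<and> ?f \<and> ?c \<and> ?d")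
proof -
  have "g \<top> = (True, True)" if J: ?J and ?t ?f
    using J[rule_format, OF tt_closed ff_closed] that by (simp add: tt_join_ff)
  moreover have "g \<bottom> = (False, False)" if M: ?M and ?t ?f
    using M[rule_format, OF tt_closed ff_closed] that by (simp add: tt_meet_ff)
  moreover have "g ` con L \<subseteq> con four \<longleftrightarrow> ?c" "g ` tot L \<subseteq> tot four \<longleftrightarrow> ?d"
    unfolding image_subset_iff four_simps by simp_all
  then have "d_lattice_hom L four g \<longleftrightarrow>
      ?J \<and> ?M \<and> g \<top> = (True, True) \<and> g \<bottom> = (False, False) \<and> ?t \<and> ?f \<and> ?c \<and> ?d"
    unfolding d_lattice_hom_def join_pres_def meet_pres_def join_four meet_four top_four bottom_four
    using lattice_L lattice_four by simp
  ultimately show ?thesis unfolding dSpec_def mem_Collect_eq by argo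
qed

lemma dSpec_meet:
  "\<lbrakk>g \<in> dSpec L; x \<in> carrier L; y \<in> carrier L\<rbrakk> \<Longrightarrow>
    g (x \<sqinter> y) = (fst (g x) \<and> fst (g y), snd (g x) \<and> snd (g y))"
  by (simp add: dSpec_iff)

text \<open>Meeting with \<open>tt L\<close> sets the second component of \<open>g x\<close> to
  \<open>False\<close> and keeps the first, so \<open>g (x \<sqinter> tt L) = tt four\<close>
  amounts to \<open>fst (g x)\<close>. An element below \<open>tt L\<close> equals its meet with
  \<open>tt L\<close>.\<close>

lemma phi_pos_image: "phi_pos L ` {a \<in> carrier L. a \<sqsubseteq> tt L} = pos_set L ` carrier L"
proof (intro equalityI subsetI)
  have eq: "phi_pos L (x \<sqinter> tt L) = pos_set L x" if "x \<in> carrier L" for x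
    using that tt_closed by (auto simp: phi_pos_def pos_set_def dSpec_meet dSpec_iff)
  show "S \<in> pos_set L ` carrier L" if S: "S \<in> phi_pos L ` {a \<in> carrier L. a \<sqsubseteq> tt L}" for S
  proof -
    obtain a where a: "a \<in> carrier L" "a \<sqsubseteq> tt L" "S = phi_pos L a" using S by blast
    then have "a \<sqinter> tt L = a" using le_iff_join[OF a(1) tt_closed] by simp
    with a eq[OF a(1)] show ?thesis by auto
  qed
  show "S \<in> phi_pos L ` {a \<in> carrier L. a \<sqsubseteq> tt L}" if "S \<in> pos_set L ` carrier L" for S
    using that eq[symmetric] tt_closed meet_right by auto
qed

lemma phi_neg_image: "phi_neg L ` {a \<in> carrier L. a \<sqsubseteq> ff L} = neg_set L ` carrier L"
proof (intro equalityI subsetI)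
  have eq: "phi_neg L (x \<sqinter> ff L) = neg_set L x" if "x \<in> carrier L" for x
    using that ff_closed by (auto simp: phi_neg_def neg_set_def dSpec_meet dSpec_iff)
  show "S \<in> neg_set L ` carrier L" if S: "S \<in> phi_neg L ` {a \<in> carrier L. a \<sqsubseteq> ff L}" for S
  proof -
    obtain a where a: "a \<in> carrier L" "a \<sqsubseteq> ff L" "S = phi_neg L a" using S by blast
    then have "a \<sqinter> ff L = a" using le_iff_join[OF a(1) ff_closed] by simp
    with a eq[OF a(1)] show ?thesis by auto
  qed
  show "S \<in> phi_neg L ` {a \<in> carrier L. a \<sqsubseteq> ff L}" if "S \<in> neg_set L ` carrier L" for S
    using that eq[symmetric] ff_closed meet_right by auto
qed

lemma d_spectrum_eq:
  "d_spectrum L = (topology_generated_by (pos_set L ` carrier L),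
                   topology_generated_by (neg_set L ` carrier L))"
  unfolding d_spectrum_def phi_pos_image phi_neg_image ..

end

section \<open>The patch topology; compactness and coherence of the spectrum\<close>

lemma openin_generated_coarsest:
  assumes "openin (topology_generated_by B) U" "\<And>b. b \<in> B \<Longrightarrow> openin T b"
  shows "openin T U"
  by (rule generate_topology_on_coarsest[of "openin T" B])
    (use assms in \<open>auto dest: openin_topology_generated_by\<close>)

text \<open>The constructible topology of the spectrum. The factors are discrete, so any condition
  on a single value \<open>g x\<close> defines a clopen set, and they are finite, so the product is
  compact.\<close>

definition patch_topology :: "('a, 'm) dlattice_scheme \<Rightarrow> ('a \<Rightarrow> bool \<times> bool) topology" where
  "patch_topology L =
     subtopology (product_topology (\<lambda>_. discrete_topology UNIV) (carrier L)) (dSpec L)"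

context d_lattice
begin

abbreviation valuations :: "('a \<Rightarrow> bool \<times> bool) topology" where
  "valuations \<equiv> product_topology (\<lambda>_. discrete_topology UNIV) (carrier L)"

lemma topspace_valuations: "topspace valuations = extensional (carrier L)"
  by (simp add: PiE_def)

lemma openin_valuations_coord:
  assumes "x \<in> carrier L"
  shows "openin valuations {g \<in> extensional (carrier L). Q (g x)}"
  using openin_continuous_map_preimage[OF continuous_map_product_projection[OF assms], of "\<lambda>_. discrete_topology UNIV" "Collect Q"]
  unfolding topspace_valuations by simp

lemma openin_valuations_coord3:
  assumes "x \<in> carrier L" "y \<in> carrier L" "z \<in> carrier L"
  shows "openin valuations {h \<in> extensional (carrier L). h x = u \<and> h y = v \<and> h z = w}"
proof -
  have "{h \<in> extensional (carrier L). h x = u \<and> h y = v \<and> h z = w} =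
      {h \<in> extensional (carrier L). h x = u} \<inter> {h \<in> extensional (carrier L). h y = v} \<inter>
      {h \<in> extensional (carrier L). h z = w}"
    by blast
  then show ?thesis
    using openin_valuations_coord[OF assms(1), of "\<lambda>a. a = u"]
      openin_valuations_coord[OF assms(2), of "\<lambda>a. a = v"]
      openin_valuations_coord[OF assms(3), of "\<lambda>a. a = w"]
    by (simp add: openin_Int)
qed

text \<open>A map that is not a homomorphism violates some clause of \<open>dSpec_iff\<close>, and
  the violation is visible at \<open>x\<close>, \<open>y\<close> and their join or meet. All maps
  with the same values at these three arguments violate the same clause, and they form an open
  set.\<close>

lemma closedin_dSpec: "closedin valuations (dSpec L)"
proof -
  have ext: "dSpec L \<subseteq> extensional (carrier L)" by (auto simp: dSpec_def)
  have "\<exists>N. openin valuations N \<and> g \<in> N \<and> N \<subseteq> extensional (carrier L) - dSpec L"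
    if g: "g \<in> extensional (carrier L)" "g \<notin> dSpec L" for g
  proof -
    have "\<exists>x\<in>carrier L. \<exists>y\<in>carrier L. \<exists>z\<in>carrier L.
        \<forall>h. h x = g x \<and> h y = g y \<and> h z = g z \<longrightarrow> h \<notin> dSpec L"
    proof (rule ccontr)
      assume "\<not> ?thesis"
      \<comment> \<open>Contrapositively, if \<open>g\<close> agrees on every triple of arguments
        with some homomorphism, possibly a different one for each triple, then it inherits each
        clause and is a homomorphism.\<close>
      then have *: "\<exists>h\<in>dSpec L. h x = g x \<and> h y = g y \<and> h z = g z"
        if "x \<in> carrier L" "y \<in> carrier L" "z \<in> carrier L" for x y z
        using that by blast
      have "g \<in> dSpec L"
        unfolding dSpec_iff
      proof (intro conjI ballI)
        show "g (x \<squnion> y) = (fst (g x) \<or> fst (g y), snd (g x) \<or> snd (g y))"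
          if "x \<in> carrier L" "y \<in> carrier L" for x y
          using *[OF that join_closed[OF that]] that dSpec_iff by metis
        show "g (x \<sqinter> y) = (fst (g x) \<and> fst (g y), snd (g x) \<and> snd (g y))"
          if "x \<in> carrier L" "y \<in> carrier L" for x y
          using *[OF that meet_closed[OF that]] that dSpec_iff by metis
        show "g (tt L) = (True, False)"
          using *[OF tt_closed tt_closed tt_closed] dSpec_iff by metis
        show "g (ff L) = (False, True)"
          using *[OF ff_closed ff_closed ff_closed] dSpec_iff by metis
        show "g x \<noteq> (True, True)" if "x \<in> con L" for x
          using *[of x x x] that con_subset dSpec_iff by (metis subsetD)
        show "g x \<noteq> (False, False)" if "x \<in> tot L" for x
          using *[of x x x] that tot_subset dSpec_iff by (metis subsetD)
      qed (rule g)
      with g show False by simp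
    qed
    then obtain x y z where xyz: "x \<in> carrier L" "y \<in> carrier L" "z \<in> carrier L"
      and "\<forall>h. h x = g x \<and> h y = g y \<and> h z = g z \<longrightarrow> h \<notin> dSpec L" by blast
    with g openin_valuations_coord3[OF xyz, of "g x" "g y" "g z"] show ?thesis
      by (intro exI[of _ "{h \<in> extensional (carrier L). h x = g x \<and> h y = g y \<and> h z = g z}"]) blast
  qed
  then have "openin valuations (extensional (carrier L) - dSpec L)"
    by (subst openin_subopen) blast
  then show ?thesis unfolding closedin_def topspace_valuations using ext by simp
qed

lemma compact_space_patch: "compact_space (patch_topology L)"
proof -
  have "compact_space valuations"
    by (simp add: compact_space_product_topology compact_space_discrete_topology)
  then show ?thesis
    unfolding patch_topology_def
    by (intro compact_space_subtopology closedin_compact_space closedin_dSpec)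
qed

lemma topspace_patch: "topspace (patch_topology L) = dSpec L"
  unfolding patch_topology_def topspace_subtopology topspace_valuations by (auto simp: dSpec_def)

lemma openin_patch_coord:
  assumes "x \<in> carrier L"
  shows "openin (patch_topology L) {g \<in> dSpec L. Q (g x)}"
proof -
  have "{g \<in> dSpec L. Q (g x)} = {g \<in> extensional (carrier L). Q (g x)} \<inter> dSpec L"
    by (auto simp: dSpec_def)
  then show ?thesis
    unfolding patch_topology_def openin_subtopology using openin_valuations_coord[OF assms] by blast
qed

lemma compactin_patch_coord:
  assumes "x \<in> carrier L"
  shows "compactin (patch_topology L) {g \<in> dSpec L. Q (g x)}"
proof -
  have "dSpec L - {g \<in> dSpec L. Q (g x)} = {g \<in> dSpec L. \<not> Q (g x)}" by blast
  then have "closedin (patch_topology L) {g \<in> dSpec L. Q (g x)}"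
    using openin_patch_coord[OF assms, of "\<lambda>a. \<not> Q a"]
    by (simp add: closedin_def topspace_patch)
  then show ?thesis by (rule closedin_compact_space[OF compact_space_patch])
qed

lemma pos_set_tt: "pos_set L (tt L) = dSpec L" and neg_set_ff: "neg_set L (ff L) = dSpec L"
  by (auto simp: pos_set_def neg_set_def dSpec_iff)

lemma Union_pos_set: "\<Union>(pos_set L ` carrier L) = dSpec L"
  and Union_neg_set: "\<Union>(neg_set L ` carrier L) = dSpec L"
  using pos_set_tt neg_set_ff tt_closed ff_closed by (auto simp: pos_set_def neg_set_def)

lemma topspace_d_spectrum:
  "topspace (fst (d_spectrum L)) = dSpec L" "topspace (snd (d_spectrum L)) = dSpec L"
  by (simp_all add: d_spectrum_eq Union_pos_set Union_neg_set)

lemma openin_pos_set: "x \<in> carrier L \<Longrightarrow> openin (fst (d_spectrum L)) (pos_set L x)"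
  and openin_neg_set: "x \<in> carrier L \<Longrightarrow> openin (snd (d_spectrum L)) (neg_set L x)"
  by (simp_all add: d_spectrum_eq topology_generated_by_Basis)

lemma pos_set_Int: "\<lbrakk>x \<in> carrier L; y \<in> carrier L\<rbrakk> \<Longrightarrow> pos_set L x \<inter> pos_set L y = pos_set L (x \<sqinter> y)"
  and neg_set_Int: "\<lbrakk>x \<in> carrier L; y \<in> carrier L\<rbrakk> \<Longrightarrow> neg_set L x \<inter> neg_set L y = neg_set L (x \<sqinter> y)"
  by (auto simp: pos_set_def neg_set_def dSpec_meet)

lemma pos_sets_Int:
    "\<lbrakk>b \<in> pos_set L ` carrier L; c \<in> pos_set L ` carrier L\<rbrakk> \<Longrightarrow> b \<inter> c \<in> pos_set L ` carrier L"
  and neg_sets_Int: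
    "\<lbrakk>b \<in> neg_set L ` carrier L; c \<in> neg_set L ` carrier L\<rbrakk> \<Longrightarrow> b \<inter> c \<in> neg_set L ` carrier L"
  by (auto simp: pos_set_Int neg_set_Int)

lemma pos_set_Un: "\<lbrakk>x \<in> carrier L; y \<in> carrier L\<rbrakk> \<Longrightarrow> pos_set L (x \<squnion> y) = pos_set L x \<union> pos_set L y"
  and neg_set_Un: "\<lbrakk>x \<in> carrier L; y \<in> carrier L\<rbrakk> \<Longrightarrow> neg_set L (x \<squnion> y) = neg_set L x \<union> neg_set L y"
  by (auto simp: pos_set_def neg_set_def dSpec_iff)

lemma openin_d_spectrum_patch:
  "openin (fst (d_spectrum L)) U \<Longrightarrow> openin (patch_topology L) U"
  "openin (snd (d_spectrum L)) U \<Longrightarrow> openin (patch_topology L) U"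
  by (auto simp: d_spectrum_eq pos_set_def neg_set_def
      elim!: openin_generated_coarsest intro!: openin_patch_coord)

lemma openin_pos_base:
  assumes "openin (fst (d_spectrum L)) U" "g \<in> U"
  shows "\<exists>x\<in>carrier L. g \<in> pos_set L x \<and> pos_set L x \<subseteq> U"
  using openin_generated_base[OF pos_sets_Int, of U g] assms by (simp add: d_spectrum_eq)

lemma openin_neg_base:
  assumes "openin (snd (d_spectrum L)) U" "g \<in> U"
  shows "\<exists>x\<in>carrier L. g \<in> neg_set L x \<and> neg_set L x \<subseteq> U"
  using openin_generated_base[OF neg_sets_Int, of U g] assms by (simp add: d_spectrum_eq)

text \<open>The basic sets are compact in the patch topology, and compactness passes to a coarser
  topology on the same set. What remains is \<open>coherent_generated\<close>, the whole space being
  the basic set of \<open>tt L\<close> or of \<open>ff L\<close>.\<close>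

lemma coherent_d_spectrum:
  "coherent_space (fst (d_spectrum L))" "coherent_space (snd (d_spectrum L))"
proof -
  have "compactin (fst (d_spectrum L)) (pos_set L x)" if "x \<in> carrier L" for x
    unfolding pos_set_def
    by (rule compactin_contractive[OF compactin_patch_coord[OF that]])
      (simp_all add: topspace_patch topspace_d_spectrum openin_d_spectrum_patch)
  then show "coherent_space (fst (d_spectrum L))"
    unfolding d_spectrum_eq fst_conv
    by (intro coherent_generated pos_sets_Int)
      (auto simp: Union_pos_set tt_closed simp flip: pos_set_tt)
  have "compactin (snd (d_spectrum L)) (neg_set L x)" if "x \<in> carrier L" for x
    unfolding neg_set_def
    by (rule compactin_contractive[OF compactin_patch_coord[OF that]])
      (simp_all add: topspace_patch topspace_d_spectrum openin_d_spectrum_patch)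
  then show "coherent_space (snd (d_spectrum L))"
    unfolding d_spectrum_eq snd_conv
    by (intro coherent_generated neg_sets_Int)
      (auto simp: Union_neg_set ff_closed simp flip: neg_set_ff)
qed

text \<open>The join of the two topologies is generated by sets open in the patch topology, so it is
  still coarser than that compact topology.\<close>

lemma bicompact_d_spectrum: "bicompact (d_spectrum L)"
proof -
  let ?J = "join_topology (d_spectrum L)"
  have top: "topspace ?J = dSpec L"
    unfolding join_topology_def topology_generated_by_topspace Union_Un_distrib
      topspace_def[symmetric] topspace_d_spectrum by simp
  have "openin (patch_topology L) U" if "openin ?J U" for U
    using that unfolding join_topology_def
    by (rule openin_generated_coarsest) (auto intro: openin_d_spectrum_patch)
  then have "compactin ?J (dSpec L)"
    using compact_space_patch compactin_contractive[of "patch_topology L" "dSpec L" ?J]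
    by (simp add: compact_space_def topspace_patch top)
  then show ?thesis by (simp add: bicompact_def compact_space_def top)
qed

lemma dSpec_eqI:
  assumes "g \<in> dSpec L" "h \<in> dSpec L"
    and "\<And>x. x \<in> carrier L \<Longrightarrow> g \<in> pos_set L x \<longleftrightarrow> h \<in> pos_set L x"
    and "\<And>x. x \<in> carrier L \<Longrightarrow> g \<in> neg_set L x \<longleftrightarrow> h \<in> neg_set L x"
  shows "g = h"
proof (rule extensionalityI)
  show "g \<in> extensional (carrier L)" "h \<in> extensional (carrier L)"
    using assms by (auto simp: dSpec_def)
  show "g x = h x" if "x \<in> carrier L" for x
    using assms(3,4)[OF that] assms(1,2) by (simp add: pos_set_def neg_set_def prod_eq_iff)
qed

end

section \<open>d-sobriety of the spectrum\<close>

text \<open>A closed set is the complement of the union of the base members that it misses. The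
  lemma recovers an irreducible closed set from its prime filter of basic sets.\<close>

lemma closedin_eq_base:
  assumes "closedin T A" "closedin T B"
    and base: "\<And>U x. \<lbrakk>openin T U; x \<in> U\<rbrakk> \<Longrightarrow> \<exists>b\<in>\<B>. x \<in> b \<and> b \<subseteq> U"
    and meets: "\<And>b. b \<in> \<B> \<Longrightarrow> A \<inter> b = {} \<longleftrightarrow> B \<inter> b = {}"
  shows "A = B"
proof -
  have "C \<subseteq> D" if C: "closedin T C" and D: "closedin T D"
    and CD: "\<And>b. b \<in> \<B> \<Longrightarrow> C \<inter> b = {} \<longleftrightarrow> D \<inter> b = {}" for C D
  proof (rule ccontr)
    assume "\<not> C \<subseteq> D"
    then obtain x where x: "x \<in> C" "x \<in> topspace T - D" using closedin_subset[OF C] by blast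
    have "openin T (topspace T - D)" using D by (simp add: closedin_def)
    from base[OF this x(2)] obtain b where "b \<in> \<B>" "x \<in> b" "b \<subseteq> topspace T - D" by blast
    with x(1) CD[of b] show False by blast
  qed
  from this[OF assms(1,2) meets] this[OF assms(2,1) meets[symmetric]] show ?thesis by blast
qed

lemma (in d_lattice) dSpec_con:
  assumes "g \<in> dSpec L" "x \<in> con L"
  shows "\<not> (fst (g x) \<and> snd (g x))"
proof -
  have "g x \<noteq> (True, True)" using assms unfolding dSpec_iff by blast
  then show ?thesis by (cases "g x") simp
qed

lemma (in d_lattice) dSpec_tot:
  assumes "g \<in> dSpec L" "x \<in> tot L"
  shows "fst (g x) \<or> snd (g x)"
proof -
  have "g x \<noteq> (False, False)" using assms unfolding dSpec_iff by blast
  then show ?thesis by (cases "g x") simp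
qed

lemma (in d_lattice) d_sober_d_spectrum: "d_sober (d_spectrum L)"
  unfolding d_sober_def
proof (intro allI impI)
  fix Kp Km
  let ?S = "fst (d_spectrum L)" and ?T = "snd (d_spectrum L)"
  assume asm: "irreducible_closedin ?S Kp \<and> irreducible_closedin ?T Km \<and>
    (\<forall>U V. openin ?S U \<and> openin ?T V \<longrightarrow>
       (U \<inter> V = {} \<longrightarrow> Kp \<inter> U = {} \<or> Km \<inter> V = {}) \<and>
       (U \<union> V = topspace ?S \<longrightarrow> Kp \<inter> U \<noteq> {} \<or> Km \<inter> V \<noteq> {}))"
  then have Kp: "irreducible_closedin ?S Kp" and Km: "irreducible_closedin ?T Km" by blast+
  have disjoint: "Kp \<inter> U = {} \<or> Km \<inter> V = {}"
    if "openin ?S U" "openin ?T V" "U \<inter> V = {}" for U V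
    using asm that by simp
  have cover: "Kp \<inter> U \<noteq> {} \<or> Km \<inter> V \<noteq> {}"
    if "openin ?S U" "openin ?T V" "U \<union> V = topspace ?S" for U V
    using asm that by simp
  have closed: "closedin ?S Kp" "closedin ?T Km"
    and sub: "Kp \<subseteq> dSpec L" "Km \<subseteq> dSpec L" and ne: "Kp \<noteq> {}" "Km \<noteq> {}"
    using Kp Km closedin_subset[of ?S Kp] closedin_subset[of ?T Km]
    by (auto simp: irreducible_closedin_def topspace_d_spectrum)
  define P where "P x \<longleftrightarrow> Kp \<inter> pos_set L x \<noteq> {}" for x
  define N where "N x \<longleftrightarrow> Km \<inter> neg_set L x \<noteq> {}" for x
  define g where "g = restrict (\<lambda>x. (P x, N x)) (carrier L)"
  have P_join: "P (x \<squnion> y) \<longleftrightarrow> P x \<or> P y" and N_join: "N (x \<squnion> y) \<longleftrightarrow> N x \<or> N y"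
    if "x \<in> carrier L" "y \<in> carrier L" for x y
    using pos_set_Un[OF that] neg_set_Un[OF that] by (auto simp: P_def N_def)
  \<comment> \<open>Left to right is monotonicity; right to left is where irreducibility of
    \<open>Kp\<close> and \<open>Km\<close> enters.\<close>
  have P_meet: "P (x \<sqinter> y) \<longleftrightarrow> P x \<and> P y" and N_meet: "N (x \<sqinter> y) \<longleftrightarrow> N x \<and> N y"
    if "x \<in> carrier L" "y \<in> carrier L" for x y
    using pos_set_Int[OF that, symmetric] neg_set_Int[OF that, symmetric]
      irreducible_closedin_Int[OF Kp openin_pos_set openin_pos_set, OF that]
      irreducible_closedin_Int[OF Km openin_neg_set openin_neg_set, OF that]
    unfolding P_def N_def by blast+
  have empty: "pos_set L (ff L) = {}" "neg_set L (tt L) = {}"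
    by (auto simp: pos_set_def neg_set_def dSpec_iff)
  \<comment> \<open>\<open>pos_set L (tt L)\<close> and \<open>neg_set L (ff L)\<close> are the
    whole spectrum, so the positive claims say that \<open>Kp\<close> and \<open>Km\<close> are
    nonempty.\<close>
  have tt_ff: "P (tt L)" "\<not> N (tt L)" "\<not> P (ff L)" "N (ff L)"
    using sub ne empty pos_set_tt neg_set_ff by (auto simp: P_def N_def)
  have con: "\<not> (P x \<and> N x)" if "x \<in> con L" for x
  proof -
    have x: "x \<in> carrier L" using that con_subset by blast
    \<comment> \<open>A homomorphism never sends an element of \<open>con L\<close> to the top of
      \<open>four\<close>; so the two basic sets of \<open>x\<close> are disjoint and condition (i)
      applies to them.\<close>
    moreover have "pos_set L x \<inter> neg_set L x = {}"
      using dSpec_con[OF _ that] by (auto simp: pos_set_def neg_set_def)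
    ultimately show ?thesis
      using disjoint[OF openin_pos_set openin_neg_set, OF x x] by (simp add: P_def N_def)
  qed
  have tot: "P x \<or> N x" if "x \<in> tot L" for x
  proof -
    have x: "x \<in> carrier L" using that tot_subset by blast
    moreover have "pos_set L x \<union> neg_set L x = topspace ?S"
      using dSpec_tot[OF _ that] by (auto simp: pos_set_def neg_set_def topspace_d_spectrum)
    ultimately show ?thesis
      using cover[OF openin_pos_set openin_neg_set, OF x x] by (simp add: P_def N_def)
  qed
  have g: "g \<in> dSpec L"
    unfolding dSpec_iff g_def
    using con tot tt_ff tt_closed ff_closed con_subset tot_subset
    by (auto simp: P_join N_join P_meet N_meet subset_iff)
  have g_pos: "g \<in> pos_set L x \<longleftrightarrow> P x" and g_neg: "g \<in> neg_set L x \<longleftrightarrow> N x"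
    if "x \<in> carrier L" for x
    using g that by (simp_all add: pos_set_def neg_set_def g_def)
  have cl_pos: "?S closure_of {h} \<inter> pos_set L x \<noteq> {} \<longleftrightarrow> h \<in> pos_set L x"
    and cl_neg: "?T closure_of {h} \<inter> neg_set L x \<noteq> {} \<longleftrightarrow> h \<in> neg_set L x"
    if "h \<in> dSpec L" "x \<in> carrier L" for h x
    using that by (auto intro!: closure_of_singleton_Int_open openin_pos_set openin_neg_set
        simp: topspace_d_spectrum)
  \<comment> \<open>The closure of \<open>{g}\<close> meets a basic set iff \<open>g\<close> belongs
    to it, and by construction \<open>g\<close> belongs to exactly the basic sets that
    \<open>Kp\<close> meets.\<close>
  have "Kp = ?S closure_of {g}"
  proof (rule closedin_eq_base[where \<B> = "pos_set L ` carrier L"])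
    show "\<exists>b\<in>pos_set L ` carrier L. h \<in> b \<and> b \<subseteq> U" if "openin ?S U" "h \<in> U" for U h
      using openin_pos_base[OF that] by blast
    show "Kp \<inter> b = {} \<longleftrightarrow> ?S closure_of {g} \<inter> b = {}" if b: "b \<in> pos_set L ` carrier L" for b
    proof -
      obtain x where x: "b = pos_set L x" "x \<in> carrier L" using b by blast
      show ?thesis using cl_pos[OF g x(2)] g_pos[OF x(2)] by (simp add: P_def x(1))
    qed
  qed (use closed in simp_all)
  moreover have "Km = ?T closure_of {g}"
  proof (rule closedin_eq_base[where \<B> = "neg_set L ` carrier L"])
    show "\<exists>b\<in>neg_set L ` carrier L. h \<in> b \<and> b \<subseteq> U" if "openin ?T U" "h \<in> U" for U h
      using openin_neg_base[OF that] by blast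
    show "Km \<inter> b = {} \<longleftrightarrow> ?T closure_of {g} \<inter> b = {}" if b: "b \<in> neg_set L ` carrier L" for b
    proof -
      obtain x where x: "b = neg_set L x" "x \<in> carrier L" using b by blast
      show ?thesis using cl_neg[OF g x(2)] g_neg[OF x(2)] by (simp add: N_def x(1))
    qed
  qed (use closed in simp_all)
  moreover have "h = g" if "h \<in> dSpec L" "Kp = ?S closure_of {h}" "Km = ?T closure_of {h}" for h
    using that g cl_pos[OF that(1)] cl_neg[OF that(1)] g_pos g_neg
    by (intro dSpec_eqI) (simp_all add: P_def N_def)
  ultimately show "\<exists>!x. x \<in> topspace ?S \<and> Kp = ?S closure_of {x} \<and> Km = ?T closure_of {x}"
    using g unfolding topspace_d_spectrum by blast
qed

lemma (in d_lattice) d_spectral_d_spectrum: "d_spectral (d_spectrum L)"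
  unfolding d_spectral_def bitopological_space_def coherent_frame_opens_iff
  by (simp add: topspace_d_spectrum bicompact_d_spectrum d_sober_d_spectrum coherent_d_spectrum)

lemma d_soberD:
  assumes X: "d_sober X"
    and Kp: "irreducible_closedin (fst X) Kp" and Km: "irreducible_closedin (snd X) Km"
    and disjoint: "\<And>U V. \<lbrakk>openin (fst X) U; openin (snd X) V; U \<inter> V = {}\<rbrakk> \<Longrightarrow>
      Kp \<inter> U = {} \<or> Km \<inter> V = {}"
    and cover: "\<And>U V. \<lbrakk>openin (fst X) U; openin (snd X) V; U \<union> V = topspace (fst X)\<rbrakk> \<Longrightarrow>
      Kp \<inter> U \<noteq> {} \<or> Km \<inter> V \<noteq> {}"
  shows "\<exists>!x. x \<in> topspace (fst X) \<and> Kp = fst X closure_of {x} \<and> Km = snd X closure_of {x}"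
  by (rule X[unfolded d_sober_def, THEN spec, THEN spec, THEN mp])
    (intro conjI allI impI Kp Km; elim conjE; rule disjoint cover; assumption)

section \<open>Invariance under homeomorphism\<close>

lemma compact_openin_homeomorphic_image:
  assumes "homeomorphic_map S T f" "compact_openin S C"
  shows "compact_openin T (f ` C)"
  using assms homeomorphic_map_openness[of S T f C] homeomorphic_map_compactness[of S T f C]
    openin_subset[of S C] by (simp add: compact_openin_def)

lemma irreducible_closedin_homeomorphic_image:
  assumes fg: "homeomorphic_maps S T f g" and K: "irreducible_closedin S K"
  shows "irreducible_closedin T (f ` K)"
  unfolding irreducible_closedin_def
proof (intro conjI allI impI)
  have f: "homeomorphic_map S T f" and g: "homeomorphic_map T S g"
    and gf: "\<And>x. x \<in> topspace S \<Longrightarrow> g (f x) = x" and fg': "\<And>y. y \<in> topspace T \<Longrightarrow> f (g y) = y"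
    using fg by (auto simp: homeomorphic_maps_map)
  have KS: "K \<subseteq> topspace S" using K closedin_subset by (auto simp: irreducible_closedin_def)
  show "closedin T (f ` K)" "f ` K \<noteq> {}"
    using K homeomorphic_map_closedness[OF f KS] by (auto simp: irreducible_closedin_def)
  fix A B assume AB: "closedin T A \<and> closedin T B \<and> f ` K = A \<union> B"
  then have sub: "A \<subseteq> topspace T" "B \<subseteq> topspace T" by (auto dest: closedin_subset)
  then have "closedin S (g ` A)" "closedin S (g ` B)"
    using AB homeomorphic_map_closedness[OF g] by auto
  moreover have "g ` f ` K = K" using KS gf by force
  then have "K = g ` A \<union> g ` B" using AB by (metis image_Un)
  ultimately have "K = g ` A \<or> K = g ` B" using K unfolding irreducible_closedin_def by blast
  moreover have "f ` g ` A = A" "f ` g ` B = B" using sub fg' by force+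
  ultimately show "f ` K = A \<or> f ` K = B" by metis
qed

lemma coherent_space_homeomorphic:
  assumes fg: "homeomorphic_maps S T f g" and T: "coherent_space T"
  shows "coherent_space S"
proof -
  have f: "homeomorphic_map S T f" and g: "homeomorphic_map T S g"
    and gf: "\<And>x. x \<in> topspace S \<Longrightarrow> g (f x) = x"
    using fg by (auto simp: homeomorphic_maps_map)
  have gfU: "g ` f ` U = U" if "U \<subseteq> topspace S" for U using that gf by force
  have "compact_space S"
    using T homeomorphic_map_compactness[OF g order_refl] homeomorphic_imp_surjective_map[OF g]
    by (simp add: coherent_space_def compact_space_def)
  moreover have "\<exists>C. compact_openin S C \<and> x \<in> C \<and> C \<subseteq> U" if U: "openin S U" "x \<in> U" for U x
  proof -
    have sub: "U \<subseteq> topspace S" using U openin_subset by blast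
    then have "openin T (f ` U)" using U homeomorphic_map_openness[OF f] by simp
    then obtain C where C: "compact_openin T C" "f x \<in> C" "C \<subseteq> f ` U"
      using T U unfolding coherent_space_def by blast
    have "x = g (f x)" using U sub gf by auto
    then have "x \<in> g ` C" using C by blast
    moreover have "g ` C \<subseteq> U" using C(3) gfU[OF sub] by blast
    ultimately show ?thesis using compact_openin_homeomorphic_image[OF g C(1)] by blast
  qed
  moreover have "compact_openin S (C \<inter> D)" if "compact_openin S C" "compact_openin S D" for C D
  proof -
    have sub: "C \<subseteq> topspace S" "D \<subseteq> topspace S"
      using that openin_subset by (auto simp: compact_openin_def)
    have "compact_openin T (f ` C \<inter> f ` D)"
      using T that compact_openin_homeomorphic_image[OF f] unfolding coherent_space_def by blast
    moreover have "f ` C \<inter> f ` D = f ` (C \<inter> D)"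
      using inj_on_image_Int[OF homeomorphic_imp_injective_map[OF f] sub] by simp
    ultimately have "compact_openin S (g ` f ` (C \<inter> D))"
      using compact_openin_homeomorphic_image[OF g] by simp
    moreover have "C \<inter> D \<subseteq> topspace S" using sub by blast
    ultimately show ?thesis using gfU by simp
  qed
  ultimately show ?thesis unfolding coherent_space_def by blast
qed

lemma topspace_join_topology:
  "topspace (join_topology X) = topspace (fst X) \<union> topspace (snd X)"
  unfolding join_topology_def topology_generated_by_topspace by (auto simp: topspace_def)

text \<open>Preimages of generators are generators. Equality of the two underlying sets makes the
  preimage in the join topology agree with the preimage in each single topology.\<close>

lemma continuous_map_join_topology:
  assumes "bicontinuous_map X Y f" "topspace (fst X) = topspace (snd X)"
  shows "continuous_map (join_topology X) (join_topology Y) f"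
  unfolding join_topology_def[of Y]
proof (rule continuous_on_generated_topo)
  have f: "continuous_map (fst X) (fst Y) f" "continuous_map (snd X) (snd Y) f"
    using assms(1) by (auto simp: bicontinuous_map_def)
  have top: "topspace (join_topology X) = topspace (fst X)" "topspace (join_topology X) = topspace (snd X)"
    using assms(2) by (simp_all add: topspace_join_topology)
  have op: "openin (join_topology X) U" if "openin (fst X) U \<or> openin (snd X) U" for U
    unfolding join_topology_def by (rule topology_generated_by_Basis) (use that in auto)
  show "openin (join_topology X) (f -` U \<inter> topspace (join_topology X))"
    if "U \<in> {U. openin (fst Y) U} \<union> {V. openin (snd Y) V}" for U
    using that
  proof
    assume "U \<in> {U. openin (fst Y) U}"
    then show ?thesis
      using f(1) op unfolding top(1) continuous_map_alt by auto
  next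
    assume "U \<in> {V. openin (snd Y) V}"
    then show ?thesis
      using f(2) op unfolding top(2) continuous_map_alt by auto
  qed
  show "f ` topspace (join_topology X) \<subseteq> \<Union> ({U. openin (fst Y) U} \<union> {V. openin (snd Y) V})"
    unfolding Union_Un_distrib topspace_def[symmetric] top(1)
    using continuous_map_image_subset_topspace[OF f(1)] by (rule le_supI1)
qed

lemma d_spectral_bihomeomorphic:
  assumes X: "topspace (fst X) = topspace (snd X)"
    and XY: "bihomeomorphic X Y" and Y: "d_spectral Y"
  shows "d_spectral X"
proof -
  obtain f g where bi: "bicontinuous_map X Y f" "bicontinuous_map Y X g"
    and gf: "\<And>x. x \<in> topspace (fst X) \<Longrightarrow> g (f x) = x"
    and fg: "\<And>y. y \<in> topspace (fst Y) \<Longrightarrow> f (g y) = y"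
    using XY unfolding bihomeomorphic_def by blast
  have topY: "topspace (fst Y) = topspace (snd Y)" and sob: "d_sober Y"
    and comp: "bicompact Y" and coh: "coherent_space (fst Y)" "coherent_space (snd Y)"
    using Y by (auto simp: d_spectral_def bitopological_space_def coherent_frame_opens_iff)
  \<comment> \<open>\<open>bihomeomorphic\<close> states the inverse laws on the first underlying
    sets; equality of the underlying sets, for \<open>X\<close> and for \<open>Y\<close>, carries
    them to the second topologies.\<close>
  have maps: "homeomorphic_maps (fst X) (fst Y) f g" "homeomorphic_maps (snd X) (snd Y) f g"
    using bi gf fg X topY by (auto simp: homeomorphic_maps_def bicontinuous_map_def)
  then have f1: "homeomorphic_map (fst X) (fst Y) f" and f2: "homeomorphic_map (snd X) (snd Y) f"
    and g1: "homeomorphic_map (fst Y) (fst X) g" and g2: "homeomorphic_map (snd Y) (snd X) g"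
    by (auto simp: homeomorphic_maps_map)
  have gY: "g ` topspace (fst Y) = topspace (fst X)"
    by (rule homeomorphic_imp_surjective_map[OF g1])
  have f_in: "f x \<in> topspace (fst Y)" if "x \<in> topspace (fst X)" for x
    using that homeomorphic_imp_surjective_map[OF f1] by blast
  have "bicompact X"
    using image_compactin[OF _ continuous_map_join_topology[OF bi(2) topY]] comp gY X topY
    by (metis bicompact_def compact_space_def sup.idem topspace_join_topology)
  moreover have "d_sober X"
    unfolding d_sober_def
  proof (intro allI impI)
    fix Kp Km
    assume asm: "irreducible_closedin (fst X) Kp \<and> irreducible_closedin (snd X) Km \<and>
      (\<forall>U V. openin (fst X) U \<and> openin (snd X) V \<longrightarrow>
         (U \<inter> V = {} \<longrightarrow> Kp \<inter> U = {} \<or> Km \<inter> V = {}) \<and>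
         (U \<union> V = topspace (fst X) \<longrightarrow> Kp \<inter> U \<noteq> {} \<or> Km \<inter> V \<noteq> {}))"
    then have irr: "irreducible_closedin (fst X) Kp" "irreducible_closedin (snd X) Km" by blast+
    then have sub: "Kp \<subseteq> topspace (fst X)" "Km \<subseteq> topspace (fst X)"
      using closedin_subset[of "fst X" Kp] closedin_subset[of "snd X" Km] X
      by (auto simp: irreducible_closedin_def)
    \<comment> \<open>This reduces (i) and (ii) for the images of \<open>Kp\<close> and
      \<open>Km\<close> under \<open>f\<close> to (i) and (ii) in \<open>X\<close>, applied to the
      images of \<open>U\<close> and \<open>V\<close> under \<open>g\<close>.\<close>
    have meets: "f ` K \<inter> U = {} \<longleftrightarrow> K \<inter> g ` U = {}"
      if "K \<subseteq> topspace (fst X)" "U \<subseteq> topspace (fst Y)" for K U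
    proof -
      have "f x \<in> U \<longleftrightarrow> x \<in> g ` U" if x: "x \<in> K" for x
      proof
        show "x \<in> g ` U" if "f x \<in> U"
          using that gf[of x] x \<open>K \<subseteq> _\<close> by (metis image_eqI subsetD)
        show "f x \<in> U" if "x \<in> g ` U"
          using that fg \<open>U \<subseteq> _\<close> by auto
      qed
      then show ?thesis by blast
    qed
    have cond: "(U \<inter> V = {} \<longrightarrow> f ` Kp \<inter> U = {} \<or> f ` Km \<inter> V = {}) \<and>
         (U \<union> V = topspace (fst Y) \<longrightarrow> f ` Kp \<inter> U \<noteq> {} \<or> f ` Km \<inter> V \<noteq> {})"
      if U: "openin (fst Y) U" and V: "openin (snd Y) V" for U V
    proof -
      have UV: "U \<subseteq> topspace (fst Y)" "V \<subseteq> topspace (fst Y)"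
        using U V topY openin_subset by metis+
      have "openin (fst X) (g ` U)" "openin (snd X) (g ` V)"
        using U V UV topY homeomorphic_map_openness[OF g1] homeomorphic_map_openness[OF g2] by auto
      moreover have "g ` U \<inter> g ` V = {}" if "U \<inter> V = {}"
        using that inj_on_image_Int[OF homeomorphic_imp_injective_map[OF g1] UV] by simp
      moreover have "g ` U \<union> g ` V = topspace (fst X)" if "U \<union> V = topspace (fst Y)"
        using that gY by (metis image_Un)
      ultimately show ?thesis
        using asm meets[OF sub(1) UV(1)] meets[OF sub(2) UV(2)] by simp
    qed
    have irrY: "irreducible_closedin (fst Y) (f ` Kp)" "irreducible_closedin (snd Y) (f ` Km)"
      using irr maps by (auto intro: irreducible_closedin_homeomorphic_image)
    have ex1: "\<exists>!y. y \<in> topspace (fst Y) \<and>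
        f ` Kp = fst Y closure_of {y} \<and> f ` Km = snd Y closure_of {y}"
      by (rule d_soberD[OF sob irrY]) (use cond in simp_all)
    have gfK: "g ` f ` K = K" if "K \<subseteq> topspace (fst X)" for K
      using that gf by force
    show "\<exists>!x. x \<in> topspace (fst X) \<and> Kp = fst X closure_of {x} \<and> Km = snd X closure_of {x}"
    proof (rule ex_ex1I)
      obtain y where y: "y \<in> topspace (fst Y)"
        "f ` Kp = fst Y closure_of {y}" "f ` Km = snd Y closure_of {y}" using ex1 by blast
      have "fst X closure_of {g y} = g ` f ` Kp" "snd X closure_of {g y} = g ` f ` Km"
        using y topY homeomorphic_map_closure_of[OF g1, of "{y}"]
          homeomorphic_map_closure_of[OF g2, of "{y}"] by auto
      moreover have "g y \<in> topspace (fst X)" using y gY by blast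
      ultimately show "\<exists>x. x \<in> topspace (fst X) \<and>
          Kp = fst X closure_of {x} \<and> Km = snd X closure_of {x}"
        using gfK sub by auto
    next
      fix x x'
      have *: "f z \<in> topspace (fst Y) \<and>
          f ` Kp = fst Y closure_of {f z} \<and> f ` Km = snd Y closure_of {f z}"
        if "z \<in> topspace (fst X)" "Kp = fst X closure_of {z}" "Km = snd X closure_of {z}" for z
        using that X f_in homeomorphic_map_closure_of[OF f1, of "{z}"]
          homeomorphic_map_closure_of[OF f2, of "{z}"] by simp
      assume x: "x \<in> topspace (fst X) \<and> Kp = fst X closure_of {x} \<and> Km = snd X closure_of {x}"
        and x': "x' \<in> topspace (fst X) \<and> Kp = fst X closure_of {x'} \<and> Km = snd X closure_of {x'}"
      have "f x = f x'" using ex1 *[of x] *[of x'] x x' by metis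
      then show "x = x'" using gf x x' by metis
    qed
  qed
  moreover have "coherent_space (fst X)" "coherent_space (snd X)"
    using coherent_space_homeomorphic maps coh by blast+
  ultimately show ?thesis
    using X by (simp add: d_spectral_def bitopological_space_def coherent_frame_opens_iff)
qed

section \<open>The d-lattice of compact open sets\<close>

text \<open>The decomposition of a d-lattice into the parts below \<open>tt\<close> and
  \<open>ff\<close> is built in: these parts are the pairs \<open>(U, {})\<close> and
  \<open>({}, V)\<close>. The logic order becomes inclusion in the first component and reverse
  inclusion in the second.\<close>

definition compact_open_dlattice :: "'a bitop \<Rightarrow> ('a set \<times> 'a set) dlattice" where
  "compact_open_dlattice X =
     \<lparr>carrier = {x. compact_openin (fst X) (fst x) \<and> compact_openin (snd X) (snd x)},
      eq = (=), le = (\<lambda>x y. fst x \<subseteq> fst y \<and> snd x \<subseteq> snd y),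
      tt = (topspace (fst X), {}), ff = ({}, topspace (snd X)),
      con = {x. compact_openin (fst X) (fst x) \<and> compact_openin (snd X) (snd x) \<and>
        fst x \<inter> snd x = {}},
      tot = {x. compact_openin (fst X) (fst x) \<and> compact_openin (snd X) (snd x) \<and>
        fst x \<union> snd x = topspace (fst X)}\<rparr>"

lemma compact_openin_empty: "compact_openin T {}"
  by (simp add: compact_openin_def)

lemma compact_openin_Un: "\<lbrakk>compact_openin T U; compact_openin T V\<rbrakk> \<Longrightarrow> compact_openin T (U \<union> V)"
  by (simp add: compact_openin_def openin_Un compactin_Un)

lemma compact_openin_Union:
  "\<lbrakk>finite \<F>; \<And>U. U \<in> \<F> \<Longrightarrow> compact_openin T U\<rbrakk> \<Longrightarrow> compact_openin T (\<Union>\<F>)"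
  by (auto simp: compact_openin_def intro: compactin_Union)

lemma compact_openin_subset: "compact_openin T U \<Longrightarrow> U \<subseteq> topspace T"
  by (simp add: compact_openin_def openin_subset)

lemma coherent_space_Int:
  "\<lbrakk>coherent_space T; compact_openin T U; compact_openin T V\<rbrakk> \<Longrightarrow> compact_openin T (U \<inter> V)"
  unfolding coherent_space_def by blast

lemma coherent_space_topspace: "coherent_space T \<Longrightarrow> compact_openin T (topspace T)"
  by (simp add: coherent_space_def compact_openin_def compact_space_def)

lemma coherent_space_base:
  "\<lbrakk>coherent_space T; openin T U; x \<in> U\<rbrakk> \<Longrightarrow> \<exists>C\<in>Collect (compact_openin T). x \<in> C \<and> C \<subseteq> U"
  unfolding coherent_space_def by blast

section \<open>Prime filters of compact open sets\<close>

text \<open>\<open>K\<close> is the largest closed set missing all compact open sets outside the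
  filter. It misses no member of the filter: such a member would be covered by finitely many sets
  outside the filter, and by primeness their union is outside as well.\<close>

lemma prime_filter_irreducible_closedin:
  assumes T: "coherent_space T"
    and Un: "\<And>U V. \<lbrakk>compact_openin T U; compact_openin T V\<rbrakk> \<Longrightarrow> P (U \<union> V) \<longleftrightarrow> P U \<or> P V"
    and Int: "\<And>U V. \<lbrakk>compact_openin T U; compact_openin T V\<rbrakk> \<Longrightarrow> P (U \<inter> V) \<longleftrightarrow> P U \<and> P V"
    and top: "P (topspace T)" and bot: "\<not> P {}"
  obtains K where "irreducible_closedin T K" "\<And>U. compact_openin T U \<Longrightarrow> K \<inter> U \<noteq> {} \<longleftrightarrow> P U"
proof
  let ?\<N> = "{W. compact_openin T W \<and> \<not> P W}"
  let ?K = "topspace T - \<Union>?\<N>"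
  have not_P_Union: "\<not> P (\<Union>\<F>)" if "finite \<F>" "\<F> \<subseteq> ?\<N>" for \<F>
    using that
  proof (induction rule: finite_induct)
    case (insert W \<F>)
    then have "compact_openin T (\<Union>\<F>)" by (intro compact_openin_Union) auto
    with insert show ?case by (simp add: Un)
  qed (simp add: bot)
  show meets: "?K \<inter> U \<noteq> {} \<longleftrightarrow> P U" if U: "compact_openin T U" for U
  proof
    show "P U" if "?K \<inter> U \<noteq> {}" using that U by blast
    show "?K \<inter> U \<noteq> {}" if "P U"
    proof
      assume "?K \<inter> U = {}"
      then have "U \<subseteq> \<Union>?\<N>" using compact_openin_subset[OF U] by blast
      moreover have "\<forall>W\<in>?\<N>. openin T W" by (simp add: compact_openin_def)
      ultimately obtain \<F> where \<F>: "finite \<F>" "\<F> \<subseteq> ?\<N>" "U \<subseteq> \<Union>\<F>"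
        using U unfolding compact_openin_def compactin_def by meson
      have "compact_openin T (\<Union>\<F>)" using \<F> by (intro compact_openin_Union) auto
      \<comment> \<open>The equivalence \<open>Un\<close> contains upward closure. Since
        \<open>U\<close> lies inside the union, this puts a finite union of sets outside the filter
        into the filter.\<close>
      then have "P (U \<union> \<Union>\<F>)" using Un[OF U] \<open>P U\<close> by blast
      with \<F> not_P_Union show False by (metis sup.absorb2)
    qed
  qed
  have closed: "closedin T ?K"
    by (intro closedin_diff closedin_topspace openin_Union) (simp add: compact_openin_def)
  show "irreducible_closedin T ?K"
    unfolding irreducible_closedin_def
  proof (intro conjI allI impI closed)
    show "?K \<noteq> {}" using meets[OF coherent_space_topspace[OF T]] top by blast
    fix A B assume AB: "closedin T A \<and> closedin T B \<and> ?K = A \<union> B"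
    \<comment> \<open>A proper closed subset of \<open>?K\<close> misses some member of the filter.
      If both \<open>A\<close> and \<open>B\<close> were proper, the intersection of two such
      members would belong to the filter, hence meet \<open>?K\<close>, and yet miss
      \<open>A\<close> and \<open>B\<close>.\<close>
    have avoid: "\<exists>C. compact_openin T C \<and> P C \<and> C \<inter> A' = {}"
      if A': "closedin T A'" "A' \<subseteq> ?K" "?K \<noteq> A'" for A'
    proof -
      obtain x where x: "x \<in> ?K" "x \<in> topspace T - A'" using A' by blast
      have "openin T (topspace T - A')" using A' by (simp add: closedin_def)
      then obtain C where C: "compact_openin T C" "x \<in> C" "C \<subseteq> topspace T - A'"
        using coherent_space_base[OF T _ x(2)] by blast
      with x(1) meets[OF C(1)] have "P C" by blast
      with C show ?thesis by blast
    qed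
    show "?K = A \<or> ?K = B"
    proof (rule ccontr)
      assume "\<not> ?thesis"
      then obtain C D where "compact_openin T C" "P C" "C \<inter> A = {}"
        and "compact_openin T D" "P D" "D \<inter> B = {}"
        using avoid[of A] avoid[of B] AB by (metis sup_ge1 sup_ge2)
      moreover from this have "?K \<inter> (C \<inter> D) \<noteq> {}"
        using meets[OF coherent_space_Int[OF T]] Int by blast
      ultimately show False using AB by blast
    qed
  qed
qed

text \<open>Coherence is what turns the compact open pairs into a d-lattice. d-sobriety and
  compactness of the join are separate hypotheses of the lemmas that recover points: injectivity of
  \<open>point\<close> rests on the first, surjectivity on both.\<close>

locale coherent_bitopology =
  fixes X :: "'a bitop"
  assumes topspace_eq: "topspace (snd X) = topspace (fst X)"
    and coherent_fst: "coherent_space (fst X)" and coherent_snd: "coherent_space (snd X)"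
begin

abbreviation L :: "('a set \<times> 'a set) dlattice" where "L \<equiv> compact_open_dlattice X"

lemma L_simps:
  "carrier L = {x. compact_openin (fst X) (fst x) \<and> compact_openin (snd X) (snd x)}"
  "(.=\<^bsub>L\<^esub>) = (=)" "(\<sqsubseteq>\<^bsub>L\<^esub>) = (\<lambda>x y. fst x \<subseteq> fst y \<and> snd x \<subseteq> snd y)"
  "tt L = (topspace (fst X), {})" "ff L = ({}, topspace (fst X))"
  "con L = {x \<in> carrier L. fst x \<inter> snd x = {}}"
  "tot L = {x \<in> carrier L. fst x \<union> snd x = topspace (fst X)}"
  by (auto simp: compact_open_dlattice_def topspace_eq)

lemma carrier_subset:
  "x \<in> carrier L \<Longrightarrow> fst x \<subseteq> topspace (fst X)" "x \<in> carrier L \<Longrightarrow> snd x \<subseteq> topspace (fst X)"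
  using compact_openin_subset[of "fst X" "fst x"] compact_openin_subset[of "snd X" "snd x"]
  by (auto simp: L_simps topspace_eq)

lemma carrier_join: "\<lbrakk>x \<in> carrier L; y \<in> carrier L\<rbrakk> \<Longrightarrow> (fst x \<union> fst y, snd x \<union> snd y) \<in> carrier L"
  and carrier_meet: "\<lbrakk>x \<in> carrier L; y \<in> carrier L\<rbrakk> \<Longrightarrow> (fst x \<inter> fst y, snd x \<inter> snd y) \<in> carrier L"
  and carrier_logic_join: "\<lbrakk>x \<in> carrier L; y \<in> carrier L\<rbrakk> \<Longrightarrow> (fst x \<union> fst y, snd x \<inter> snd y) \<in> carrier L"
  and carrier_logic_meet: "\<lbrakk>x \<in> carrier L; y \<in> carrier L\<rbrakk> \<Longrightarrow> (fst x \<inter> fst y, snd x \<union> snd y) \<in> carrier L"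
  by (simp_all add: L_simps compact_openin_Un coherent_space_Int coherent_fst coherent_snd)

lemma carrier_top: "(topspace (fst X), topspace (fst X)) \<in> carrier L"
  and carrier_bottom: "({}, {}) \<in> carrier L"
  and carrier_tt: "(topspace (fst X), {}) \<in> carrier L"
  and carrier_ff: "({}, topspace (fst X)) \<in> carrier L"
  using coherent_space_topspace[OF coherent_fst] coherent_space_topspace[OF coherent_snd]
  by (simp_all add: L_simps compact_openin_empty topspace_eq)

lemma join_L: "\<lbrakk>x \<in> carrier L; y \<in> carrier L\<rbrakk> \<Longrightarrow> x \<squnion>\<^bsub>L\<^esub> y = (fst x \<union> fst y, snd x \<union> snd y)"
  by (rule join_eqI) (auto simp: carrier_join L_simps(3) prod_eq_iff)

lemma meet_L: "\<lbrakk>x \<in> carrier L; y \<in> carrier L\<rbrakk> \<Longrightarrow> x \<sqinter>\<^bsub>L\<^esub> y = (fst x \<inter> fst y, snd x \<inter> snd y)"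
  by (rule meet_eqI) (auto simp: carrier_meet L_simps(3) prod_eq_iff)

lemma top_L: "\<top>\<^bsub>L\<^esub> = (topspace (fst X), topspace (fst X))"
proof (rule top_eqI[OF carrier_top])
  show "z \<sqsubseteq>\<^bsub>L\<^esub> (topspace (fst X), topspace (fst X))" if "z \<in> carrier L" for z
    using carrier_subset[OF that] by (simp add: L_simps(3))
  then show "z = (topspace (fst X), topspace (fst X))"
    if "z \<in> carrier L" "(topspace (fst X), topspace (fst X)) \<sqsubseteq>\<^bsub>L\<^esub> z" for z
    using carrier_subset[OF that(1)] that(2) by (auto simp: L_simps(3) prod_eq_iff)
qed

lemma bottom_L: "\<bottom>\<^bsub>L\<^esub> = ({}, {})"
  by (rule bottom_eqI[OF carrier_bottom]) (auto simp: L_simps(3) prod_eq_iff)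

text \<open>Meeting with \<open>tt L\<close> keeps only the first component, meeting with
  \<open>ff L\<close> only the second.\<close>

lemma logic_order_le:
  assumes "x \<in> carrier L" "y \<in> carrier L"
  shows "x \<sqsubseteq>\<^bsub>logic_order L\<^esub> y \<longleftrightarrow> fst x \<subseteq> fst y \<and> snd y \<subseteq> snd x"
  using assms carrier_subset[OF assms(1)] carrier_subset[OF assms(2)] carrier_tt carrier_ff
  by (simp add: logic_order_def meet_L L_simps(3-5) Int_absorb2)

lemma carrier_logic_order: "carrier (logic_order L) = carrier L"
  by (simp add: logic_order_def)

lemma join_logic_order:
  assumes "x \<in> carrier L" "y \<in> carrier L"
  shows "x \<squnion>\<^bsub>logic_order L\<^esub> y = (fst x \<union> fst y, snd x \<inter> snd y)"
  using assms carrier_logic_join[OF assms]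
  by (intro join_eqI) (auto simp: carrier_logic_order logic_order_le prod_eq_iff)

lemma meet_logic_order:
  assumes "x \<in> carrier L" "y \<in> carrier L"
  shows "x \<sqinter>\<^bsub>logic_order L\<^esub> y = (fst x \<inter> fst y, snd x \<union> snd y)"
  using assms carrier_logic_meet[OF assms]
  by (intro meet_eqI) (auto simp: carrier_logic_order logic_order_le prod_eq_iff)

lemma bounded_lattice_L: "Lattice.bounded_lattice L"
proof -
  interpret partial_order L
    by unfold_locales (auto simp: L_simps(2,3) prod_eq_iff)
  show ?thesis
  proof
    show "\<exists>s. is_lub L s {x, y}" if "x \<in> carrier L" "y \<in> carrier L" for x y
      by (rule exI[of _ "(fst x \<union> fst y, snd x \<union> snd y)"], rule is_lub_pairI)
        (use that carrier_join[OF that] in \<open>auto simp: L_simps(3)\<close>)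
    show "\<exists>s. is_glb L s {x, y}" if "x \<in> carrier L" "y \<in> carrier L" for x y
      by (rule exI[of _ "(fst x \<inter> fst y, snd x \<inter> snd y)"], rule is_glb_pairI)
        (use that carrier_meet[OF that] in \<open>auto simp: L_simps(3)\<close>)
    show "\<exists>b. least L b (carrier L)"
      by (rule exI[of _ "({}, {})"]) (use carrier_bottom in \<open>simp add: least_def L_simps(3)\<close>)
    show "\<exists>t. greatest L t (carrier L)"
      by (rule exI[of _ "(topspace (fst X), topspace (fst X))"])
        (use carrier_top carrier_subset in \<open>auto simp: greatest_def L_simps(3)\<close>)
  qed
qed

lemma d_lattice_L: "d_lattice L"
proof (intro d_lattice.intro distributive_bounded_lattice.intro
    distributive_bounded_lattice_axioms.intro d_lattice_axioms.intro bounded_lattice_L)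
  show "x \<sqinter>\<^bsub>L\<^esub> (y \<squnion>\<^bsub>L\<^esub> z) = (x \<sqinter>\<^bsub>L\<^esub> y) \<squnion>\<^bsub>L\<^esub> (x \<sqinter>\<^bsub>L\<^esub> z)"
    if "x \<in> carrier L" "y \<in> carrier L" "z \<in> carrier L" for x y z
    using that by (simp add: join_L meet_L carrier_join carrier_meet Int_Un_distrib)
  show "tt L \<in> carrier L" "ff L \<in> carrier L" by (simp_all only: L_simps(4,5) carrier_tt carrier_ff)
  show "tt L \<squnion>\<^bsub>L\<^esub> ff L = \<top>\<^bsub>L\<^esub>" "tt L \<sqinter>\<^bsub>L\<^esub> ff L = \<bottom>\<^bsub>L\<^esub>"
    by (simp_all add: L_simps(4,5) join_L meet_L carrier_tt carrier_ff top_L bottom_L)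
  show "con L \<subseteq> carrier L" "tot L \<subseteq> carrier L" by (auto simp: L_simps(6,7))
  show "tt L \<in> con L" "ff L \<in> con L" "tt L \<in> tot L" "ff L \<in> tot L"
    by (simp_all add: L_simps(4-7) carrier_tt carrier_ff)
  show "x \<in> con L" if "x \<in> carrier L" "y \<in> con L" "x \<sqsubseteq>\<^bsub>L\<^esub> y" for x y
    using that unfolding L_simps(3,6) by blast
  show "y \<in> tot L" if "x \<in> tot L" "y \<in> carrier L" "x \<sqsubseteq>\<^bsub>L\<^esub> y" for x y
    using that carrier_subset[of y] unfolding L_simps(3,7) by blast
  show "sublattice (con L) (logic_order L)" "sublattice (tot L) (logic_order L)"
    by (auto simp: sublattice_def carrier_logic_order join_logic_order meet_logic_order L_simps(6,7)
        carrier_logic_join carrier_logic_meet)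
  show "a \<sqsubseteq>\<^bsub>L\<^esub> b" if ab: "a \<in> con L" "b \<in> tot L"
    "a \<sqinter>\<^bsub>L\<^esub> tt L = b \<sqinter>\<^bsub>L\<^esub> tt L \<or> a \<sqinter>\<^bsub>L\<^esub> ff L = b \<sqinter>\<^bsub>L\<^esub> ff L" for a b
  proof -
    have "a \<in> carrier L" "b \<in> carrier L" using ab by (auto simp: L_simps(6,7))
    moreover from this have "fst a = fst b \<or> snd a = snd b"
      using ab(3) carrier_subset[of a] carrier_subset[of b]
      by (simp add: L_simps(4,5) meet_L carrier_tt carrier_ff Int_absorb2)
    \<comment> \<open>If the first components agree, a point of \<open>snd a\<close> is not in
      \<open>fst a\<close>, hence not in \<open>fst b\<close>, hence in \<open>snd b\<close> because
      \<open>b\<close> covers the space. The other case is symmetric.\<close>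
    ultimately show ?thesis
      using ab(1,2) carrier_subset[of a] unfolding L_simps(3,6,7) by blast
  qed
  assume "{tt L, ff L} = {\<top>\<^bsub>L\<^esub>, \<bottom>\<^bsub>L\<^esub>}"
  \<comment> \<open>\<open>tt L\<close> has the whole space and the empty set as components, while
    top and bottom have equal components.\<close>
  then have "topspace (fst X) = {}"
    by (auto simp: L_simps(4,5) top_L bottom_L doubleton_eq_iff)
  then have "x = ({}, {})" if "x \<in> carrier L" for x
    using carrier_subset[OF that] by (simp add: prod_eq_iff)
  then have "carrier L = {({}, {})}" using carrier_bottom by blast
  then show "\<exists>x. carrier L = {x}" by blast
qed

end

section \<open>The homeomorphism onto the spectrum\<close>

context coherent_bitopology
begin

interpretation L: d_lattice L by (rule d_lattice_L)

text \<open>The compact open neighbourhoods of \<open>x\<close> in both topologies, as a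
  homomorphism; \<open>restrict\<close> makes it extensional, as elements of \<open>dSpec\<close>
  are.\<close>

definition point :: "'a \<Rightarrow> 'a set \<times> 'a set \<Rightarrow> bool \<times> bool" where
  "point x = restrict (\<lambda>c. (x \<in> fst c, x \<in> snd c)) (carrier L)"

lemma point_dSpec:
  assumes x: "x \<in> topspace (fst X)"
  shows "point x \<in> dSpec L"
  unfolding L.dSpec_iff
proof (intro conjI ballI)
  show "point x \<in> extensional (carrier L)" by (simp add: point_def)
  show "point x (c \<squnion>\<^bsub>L\<^esub> d) = (fst (point x c) \<or> fst (point x d), snd (point x c) \<or> snd (point x d))"
    if "c \<in> carrier L" "d \<in> carrier L" for c d
    using that by (simp add: point_def join_L carrier_join)
  show "point x (c \<sqinter>\<^bsub>L\<^esub> d) = (fst (point x c) \<and> fst (point x d), snd (point x c) \<and> snd (point x d))"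
    if "c \<in> carrier L" "d \<in> carrier L" for c d
    using that by (simp add: point_def meet_L carrier_meet)
  show "point x (tt L) = (True, False)" "point x (ff L) = (False, True)"
    using x by (simp_all add: point_def L_simps(4,5) carrier_tt carrier_ff)
  show "point x c \<noteq> (True, True)" if "c \<in> con L" for c
    using that by (auto simp: point_def L_simps(6))
  show "point x c \<noteq> (False, False)" if "c \<in> tot L" for c
    using that x by (auto simp: point_def L_simps(7))
qed

lemma point_pos_set:
  "\<lbrakk>x \<in> topspace (fst X); c \<in> carrier L\<rbrakk> \<Longrightarrow> point x \<in> pos_set L c \<longleftrightarrow> x \<in> fst c"
  and point_neg_set:
  "\<lbrakk>x \<in> topspace (fst X); c \<in> carrier L\<rbrakk> \<Longrightarrow> point x \<in> neg_set L c \<longleftrightarrow> x \<in> snd c"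
  by (simp_all add: pos_set_def neg_set_def point_dSpec) (simp_all add: point_def)

lemma carrier_pos: "compact_openin (fst X) U \<Longrightarrow> (U, {}) \<in> carrier L"
  and carrier_neg: "compact_openin (snd X) V \<Longrightarrow> ({}, V) \<in> carrier L"
  by (simp_all add: L_simps compact_openin_empty)

text \<open>Points with the same image have the same compact open neighbourhoods, hence the same
  closures in both topologies. The pair of closures of a single point satisfies (i) and (ii), with
  that point as witness, so the uniqueness part of d-sobriety acts as a joint T0 axiom.\<close>

lemma inj_on_point:
  assumes "d_sober X"
  shows "inj_on point (topspace (fst X))"
proof (rule inj_onI)
  fix x y assume x: "x \<in> topspace (fst X)" and y: "y \<in> topspace (fst X)" and xy: "point x = point y"
  have pos: "x \<in> U \<longleftrightarrow> y \<in> U" if "compact_openin (fst X) U" for U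
    using point_pos_set[OF x carrier_pos[OF that]] point_pos_set[OF y carrier_pos[OF that]] xy by simp
  have neg: "x \<in> V \<longleftrightarrow> y \<in> V" if "compact_openin (snd X) V" for V
    using point_neg_set[OF x carrier_neg[OF that]] point_neg_set[OF y carrier_neg[OF that]] xy by simp
  have x': "x \<in> topspace (snd X)" and y': "y \<in> topspace (snd X)" using x y topspace_eq by simp_all
  have "fst X closure_of {x} = fst X closure_of {y}"
  proof (rule closedin_eq_base[where T = "fst X" and \<B> = "Collect (compact_openin (fst X))"])
    show "fst X closure_of {x} \<inter> U = {} \<longleftrightarrow> fst X closure_of {y} \<inter> U = {}"
      if "U \<in> Collect (compact_openin (fst X))" for U
      using that pos[of U] closure_of_singleton_Int_open[OF _ x] closure_of_singleton_Int_open[OF _ y]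
      unfolding mem_Collect_eq compact_openin_def by metis
  qed (use coherent_space_base[OF coherent_fst] in simp_all)
  moreover have "snd X closure_of {x} = snd X closure_of {y}"
  proof (rule closedin_eq_base[where T = "snd X" and \<B> = "Collect (compact_openin (snd X))"])
    show "snd X closure_of {x} \<inter> V = {} \<longleftrightarrow> snd X closure_of {y} \<inter> V = {}"
      if "V \<in> Collect (compact_openin (snd X))" for V
      using that neg[of V] closure_of_singleton_Int_open[OF _ x'] closure_of_singleton_Int_open[OF _ y']
      unfolding mem_Collect_eq compact_openin_def by metis
  qed (use coherent_space_base[OF coherent_snd] in simp_all)
  moreover have "\<exists>!z. z \<in> topspace (fst X) \<and>
      fst X closure_of {x} = fst X closure_of {z} \<and> snd X closure_of {x} = snd X closure_of {z}"
  proof (rule d_soberD[OF assms])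
    show "fst X closure_of {x} \<inter> U = {} \<or> snd X closure_of {x} \<inter> V = {}"
      if "openin (fst X) U" "openin (snd X) V" "U \<inter> V = {}" for U V
      using that closure_of_singleton_Int_open[OF _ x] closure_of_singleton_Int_open[OF _ x'] by blast
    show "fst X closure_of {x} \<inter> U \<noteq> {} \<or> snd X closure_of {x} \<inter> V \<noteq> {}"
      if "openin (fst X) U" "openin (snd X) V" "U \<union> V = topspace (fst X)" for U V
      using that x closure_of_singleton_Int_open[OF _ x] closure_of_singleton_Int_open[OF _ x'] by blast
  qed (simp_all add: irreducible_closedin_closure_of_singleton x x')
  ultimately show "x = y" using x y by auto
qed

text \<open>Here compactness of the join is used. The compact open sets of the first topology inside
  \<open>U\<close> and those of the second inside \<open>V\<close> together cover the space; a
  finite subcover, grouped by the family its members belong to, yields \<open>C\<close> and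
  \<open>D\<close>.\<close>

lemma compact_open_cover:
  assumes comp: "bicompact X"
    and U: "openin (fst X) U" and V: "openin (snd X) V" and UV: "U \<union> V = topspace (fst X)"
  obtains C D where "compact_openin (fst X) C" "C \<subseteq> U" "compact_openin (snd X) D" "D \<subseteq> V"
    "C \<union> D = topspace (fst X)"
proof -
  let ?P = "{C. compact_openin (fst X) C \<and> C \<subseteq> U}" and ?N = "{D. compact_openin (snd X) D \<and> D \<subseteq> V}"
  have "topspace (fst X) \<subseteq> \<Union>(?P \<union> ?N)"
  proof
    fix x assume "x \<in> topspace (fst X)"
    then consider "x \<in> U" | "x \<in> V" using UV by blast
    then show "x \<in> \<Union>(?P \<union> ?N)"
    proof cases
      case 1
      then show ?thesis using coherent_space_base[OF coherent_fst U] by blast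
    next
      case 2
      then show ?thesis using coherent_space_base[OF coherent_snd V] by blast
    qed
  qed
  moreover have "openin (join_topology X) W" if "W \<in> ?P \<union> ?N" for W
    unfolding join_topology_def
    by (rule topology_generated_by_Basis) (use that in \<open>auto simp: compact_openin_def\<close>)
  moreover have "compactin (join_topology X) (topspace (fst X))"
    using comp topspace_eq by (simp add: bicompact_def compact_space_def topspace_join_topology)
  ultimately obtain \<F> where \<F>: "finite \<F>" "\<F> \<subseteq> ?P \<union> ?N" "topspace (fst X) \<subseteq> \<Union>\<F>"
    unfolding compactin_def by meson
  have C: "compact_openin (fst X) (\<Union>(\<F> \<inter> ?P))" and D: "compact_openin (snd X) (\<Union>(\<F> \<inter> ?N))"
    using \<F>(1) by (auto intro!: compact_openin_Union)
  have sub: "\<Union>(\<F> \<inter> ?P) \<subseteq> U" "\<Union>(\<F> \<inter> ?N) \<subseteq> V" by blast+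
  have "\<Union>(\<F> \<inter> ?P) \<union> \<Union>(\<F> \<inter> ?N) = topspace (fst X)"
  proof
    show "\<Union>(\<F> \<inter> ?P) \<union> \<Union>(\<F> \<inter> ?N) \<subseteq> topspace (fst X)" using UV by blast
    show "topspace (fst X) \<subseteq> \<Union>(\<F> \<inter> ?P) \<union> \<Union>(\<F> \<inter> ?N)" using \<F>(2,3) by blast
  qed
  with C sub(1) D sub(2) show thesis by (rule that)
qed

lemma point_surj:
  assumes sob: "d_sober X" and comp: "bicompact X" and g: "g \<in> dSpec L"
  shows "\<exists>x\<in>topspace (fst X). point x = g"
proof -
  have join: "g (c \<squnion>\<^bsub>L\<^esub> d) = (fst (g c) \<or> fst (g d), snd (g c) \<or> snd (g d))"
    if "c \<in> carrier L" "d \<in> carrier L" for c d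
    using g that unfolding L.dSpec_iff by simp
  have meet: "g (c \<sqinter>\<^bsub>L\<^esub> d) = (fst (g c) \<and> fst (g d), snd (g c) \<and> snd (g d))"
    if "c \<in> carrier L" "d \<in> carrier L" for c d
    using g that by (rule L.dSpec_meet)
  have g_tt: "g (topspace (fst X), {}) = (True, False)" and g_ff: "g ({}, topspace (fst X)) = (False, True)"
    using g unfolding L.dSpec_iff L_simps(4,5) by simp_all
  have g_bot: "g ({}, {}) = (False, False)"
    using meet[OF carrier_tt carrier_ff] g_tt g_ff by (simp add: meet_L carrier_tt carrier_ff)
  \<comment> \<open>The traces of \<open>g\<close> on the parts below \<open>tt L\<close> and
    \<open>ff L\<close> are the two prime filters.\<close>
  define P where "P U \<longleftrightarrow> fst (g (U, {}))" for U
  define N where "N V \<longleftrightarrow> snd (g ({}, V))" for V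
  obtain Kp where Kp: "irreducible_closedin (fst X) Kp"
    and Kp_P: "\<And>U. compact_openin (fst X) U \<Longrightarrow> Kp \<inter> U \<noteq> {} \<longleftrightarrow> P U"
  proof (rule prime_filter_irreducible_closedin[OF coherent_fst, of P])
    show "P (U \<union> V) \<longleftrightarrow> P U \<or> P V" "P (U \<inter> V) \<longleftrightarrow> P U \<and> P V"
      if "compact_openin (fst X) U" "compact_openin (fst X) V" for U V
      using join[OF carrier_pos carrier_pos, OF that] meet[OF carrier_pos carrier_pos, OF that]
      by (simp_all add: P_def join_L meet_L carrier_pos that)
  qed (simp_all add: P_def g_tt g_bot)
  obtain Km where Km: "irreducible_closedin (snd X) Km"
    and Km_N: "\<And>V. compact_openin (snd X) V \<Longrightarrow> Km \<inter> V \<noteq> {} \<longleftrightarrow> N V"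
  proof (rule prime_filter_irreducible_closedin[OF coherent_snd, of N])
    show "N (U \<union> V) \<longleftrightarrow> N U \<or> N V" "N (U \<inter> V) \<longleftrightarrow> N U \<and> N V"
      if "compact_openin (snd X) U" "compact_openin (snd X) V" for U V
      using join[OF carrier_neg carrier_neg, OF that] meet[OF carrier_neg carrier_neg, OF that]
      by (simp_all add: N_def join_L meet_L carrier_neg that)
  qed (simp_all add: N_def g_ff g_bot topspace_eq)
  \<comment> \<open>Meets with \<open>tt L\<close> and \<open>ff L\<close> separate a pair into its
    components, so \<open>g\<close> is determined by its two filters.\<close>
  have g_eq: "g (U, V) = (P U, N V)" if U: "compact_openin (fst X) U" and V: "compact_openin (snd X) V" for U V
  proof -
    have c: "(U, V) \<in> carrier L" using U V by (simp add: L_simps)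
    have sub: "U \<subseteq> topspace (fst X)" "V \<subseteq> topspace (fst X)" using carrier_subset[OF c] by simp_all
    have "g (U, {}) = (fst (g (U, V)), False)" "g ({}, V) = (False, snd (g (U, V)))"
      using meet[OF c carrier_tt] meet[OF c carrier_ff] sub
      by (simp_all add: meet_L c carrier_tt carrier_ff g_tt g_ff Int_absorb2)
    then show ?thesis by (simp add: P_def N_def prod_eq_iff)
  qed
  have "\<exists>!x. x \<in> topspace (fst X) \<and> Kp = fst X closure_of {x} \<and> Km = snd X closure_of {x}"
  proof (rule d_soberD[OF sob Kp Km])
    fix U V assume U: "openin (fst X) U" and V: "openin (snd X) V"
    \<comment> \<open>Compact open neighbourhoods inside \<open>U\<close> and \<open>V\<close> of
      points of \<open>Kp\<close> and \<open>Km\<close> would form a pair in \<open>con L\<close>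
      that \<open>g\<close> sends to the top of \<open>four\<close>.\<close>
    show "Kp \<inter> U = {} \<or> Km \<inter> V = {}" if UV: "U \<inter> V = {}"
    proof (rule ccontr)
      assume "\<not> ?thesis"
      then obtain x y where xy: "x \<in> Kp" "x \<in> U" "y \<in> Km" "y \<in> V" by blast
      obtain C where C: "compact_openin (fst X) C" "x \<in> C" "C \<subseteq> U"
        using coherent_space_base[OF coherent_fst U xy(2)] by blast
      obtain D where D: "compact_openin (snd X) D" "y \<in> D" "D \<subseteq> V"
        using coherent_space_base[OF coherent_snd V xy(4)] by blast
      have "(C, D) \<in> con L" using C D UV unfolding L_simps by auto
      moreover have "P C" "N D" using xy C D Kp_P[OF C(1)] Km_N[OF D(1)] by blast+
      ultimately show False using L.dSpec_con[OF g] g_eq[OF C(1) D(1)] by fastforce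
    qed
    \<comment> \<open>A compact open cover inside \<open>U\<close> and \<open>V\<close> is a pair in
      \<open>tot L\<close>, so \<open>g\<close> puts one of its components into the corresponding
      filter.\<close>
    show "Kp \<inter> U \<noteq> {} \<or> Km \<inter> V \<noteq> {}" if UV: "U \<union> V = topspace (fst X)"
    proof -
      obtain C D where C: "compact_openin (fst X) C" "C \<subseteq> U"
        and D: "compact_openin (snd X) D" "D \<subseteq> V" and CD: "C \<union> D = topspace (fst X)"
        using compact_open_cover[OF comp U V UV] by blast
      have "(C, D) \<in> tot L" using C D CD unfolding L_simps by auto
      then have "P C \<or> N D" using L.dSpec_tot[OF g] g_eq[OF C(1) D(1)] by fastforce
      then show ?thesis using Kp_P[OF C(1)] Km_N[OF D(1)] C D by blast
    qed
  qed
  then obtain x where x: "x \<in> topspace (fst X)" "Kp = fst X closure_of {x}" "Km = snd X closure_of {x}"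
    by blast
  have "point x = g"
  proof (rule extensionalityI[of _ "carrier L"])
    show "g \<in> extensional (carrier L)" using g by (simp add: dSpec_def)
    fix c assume c: "c \<in> carrier L"
    then have co: "compact_openin (fst X) (fst c)" "compact_openin (snd X) (snd c)"
      by (simp_all add: L_simps)
    have "x \<in> fst c \<longleftrightarrow> P (fst c)"
      using closure_of_singleton_Int_open[of "fst X" "fst c" x] Kp_P[OF co(1)] co x
      by (simp add: compact_openin_def)
    moreover have "x \<in> snd c \<longleftrightarrow> N (snd c)"
      using closure_of_singleton_Int_open[of "snd X" "snd c" x] Km_N[OF co(2)] co x topspace_eq
      by (simp add: compact_openin_def)
    ultimately show "point x c = g c"
      using g_eq[OF co] c by (simp add: point_def)
  qed (simp add: point_def)
  with x show ?thesis by blast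
qed

text \<open>Because every element of \<open>dSpec L\<close> has the form \<open>point y\<close>, the
  basic set of \<open>(C, {})\<close> lies inside the image of \<open>C\<close>. Images of open sets
  are thus unions of basic sets; likewise for the second topology.\<close>

lemma openin_point_image:
  assumes "d_sober X" "bicompact X"
  shows "openin (fst X) U \<Longrightarrow> openin (fst (d_spectrum L)) (point ` U)"
    and "openin (snd X) U \<Longrightarrow> openin (snd (d_spectrum L)) (point ` U)"
proof -
  assume U: "openin (fst X) U"
  have "\<exists>W. openin (fst (d_spectrum L)) W \<and> h \<in> W \<and> W \<subseteq> point ` U" if h: "h \<in> point ` U" for h
  proof -
    obtain x where x: "x \<in> U" "h = point x" using h by blast
    obtain C where C: "compact_openin (fst X) C" "x \<in> C" "C \<subseteq> U"
      using coherent_space_base[OF coherent_fst U x(1)] by blast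
    have "pos_set L (C, {}) \<subseteq> point ` U"
    proof
      fix k assume k: "k \<in> pos_set L (C, {})"
      then obtain y where y: "y \<in> topspace (fst X)" "k = point y"
        using point_surj[OF assms] unfolding pos_set_def by blast
      with k C point_pos_set[OF y(1) carrier_pos[OF C(1)]] show "k \<in> point ` U" by auto
    qed
    moreover have "x \<in> topspace (fst X)" using x U openin_subset by blast
    then have "h \<in> pos_set L (C, {})" using x C point_pos_set[OF _ carrier_pos[OF C(1)]] by simp
    ultimately show ?thesis using L.openin_pos_set[OF carrier_pos[OF C(1)]] by blast
  qed
  then show "openin (fst (d_spectrum L)) (point ` U)" by (subst openin_subopen) blast
next
  assume U: "openin (snd X) U"
  have "\<exists>W. openin (snd (d_spectrum L)) W \<and> h \<in> W \<and> W \<subseteq> point ` U" if h: "h \<in> point ` U" for h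
  proof -
    obtain x where x: "x \<in> U" "h = point x" using h by blast
    obtain C where C: "compact_openin (snd X) C" "x \<in> C" "C \<subseteq> U"
      using coherent_space_base[OF coherent_snd U x(1)] by blast
    have "neg_set L ({}, C) \<subseteq> point ` U"
    proof
      fix k assume k: "k \<in> neg_set L ({}, C)"
      then obtain y where y: "y \<in> topspace (fst X)" "k = point y"
        using point_surj[OF assms] unfolding neg_set_def by blast
      with k C point_neg_set[OF y(1) carrier_neg[OF C(1)]] show "k \<in> point ` U" by auto
    qed
    moreover have "x \<in> topspace (fst X)" using x U openin_subset topspace_eq by blast
    then have "h \<in> neg_set L ({}, C)" using x C point_neg_set[OF _ carrier_neg[OF C(1)]] by simp
    ultimately show ?thesis using L.openin_neg_set[OF carrier_neg[OF C(1)]] by blast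
  qed
  then show "openin (snd (d_spectrum L)) (point ` U)" by (subst openin_subopen) blast
qed

lemma bihomeomorphic_d_spectrum:
  assumes sob: "d_sober X" and comp: "bicompact X"
  shows "bihomeomorphic X (d_spectrum L)"
proof -
  let ?S = "topspace (fst X)"
  have bij: "bij_betw point ?S (dSpec L)"
    using inj_on_point[OF sob] point_dSpec point_surj[OF sob comp]
    by (auto simp: bij_betw_def)
  have image: "point ` ?S = dSpec L" using bij by (simp add: bij_betw_def)
  have pos: "continuous_map (fst X) (fst (d_spectrum L)) point"
    unfolding L.d_spectrum_eq fst_conv
  proof (rule continuous_on_generated_topo)
    show "point ` ?S \<subseteq> \<Union>(pos_set L ` carrier L)" by (simp add: image L.Union_pos_set)
    fix W assume "W \<in> pos_set L ` carrier L"
    then obtain c where c: "c \<in> carrier L" "W = pos_set L c" by blast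
    \<comment> \<open>The preimage of a basic set is the compact open component that indexes
      it.\<close>
    then have "point -` W \<inter> ?S = fst c" using point_pos_set carrier_subset(1) by blast
    then show "openin (fst X) (point -` W \<inter> ?S)" using c by (simp add: L_simps compact_openin_def)
  qed
  have neg: "continuous_map (snd X) (snd (d_spectrum L)) point"
    unfolding L.d_spectrum_eq snd_conv
  proof (rule continuous_on_generated_topo; unfold topspace_eq)
    show "point ` ?S \<subseteq> \<Union>(neg_set L ` carrier L)" by (simp add: image L.Union_neg_set)
    fix W assume "W \<in> neg_set L ` carrier L"
    then obtain c where c: "c \<in> carrier L" "W = neg_set L c" by blast
    then have "point -` W \<inter> ?S = snd c" using point_neg_set carrier_subset(2) by blast
    then show "openin (snd X) (point -` W \<inter> ?S)" using c by (simp add: L_simps compact_openin_def)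
  qed
  have inv: "inv_into ?S point g \<in> ?S" "point (inv_into ?S point g) = g" if "g \<in> dSpec L" for g
    using that image by (auto intro: inv_into_into f_inv_into_f)
  have inv': "inv_into ?S point (point x) = x" if "x \<in> ?S" for x
    using that inj_on_point[OF sob] by simp
  \<comment> \<open>Preimages under the inverse are images under \<open>point\<close>, so continuity
    of the inverse is \<open>openin_point_image\<close>.\<close>
  have preimage: "{g \<in> dSpec L. inv_into ?S point g \<in> U} = point ` U" if "U \<subseteq> ?S" for U
  proof
    show "{g \<in> dSpec L. inv_into ?S point g \<in> U} \<subseteq> point ` U" using inv(2) by force
    show "point ` U \<subseteq> {g \<in> dSpec L. inv_into ?S point g \<in> U}" using that inv' point_dSpec by auto
  qed
  have "continuous_map (fst (d_spectrum L)) (fst X) (inv_into ?S point)"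
    unfolding continuous_map_def L.topspace_d_spectrum
  proof (intro conjI allI impI)
    show "inv_into ?S point \<in> dSpec L \<rightarrow> ?S" using inv(1) by blast
    show "openin (fst (d_spectrum L)) {g \<in> dSpec L. inv_into ?S point g \<in> U}"
      if "openin (fst X) U" for U
      using openin_point_image(1)[OF assms that] preimage openin_subset[OF that] topspace_eq by simp
  qed
  moreover have "continuous_map (snd (d_spectrum L)) (snd X) (inv_into ?S point)"
    unfolding continuous_map_def L.topspace_d_spectrum topspace_eq
  proof (intro conjI allI impI)
    show "inv_into ?S point \<in> dSpec L \<rightarrow> ?S" using inv(1) by blast
    show "openin (snd (d_spectrum L)) {g \<in> dSpec L. inv_into ?S point g \<in> U}"
      if "openin (snd X) U" for U
      using openin_point_image(2)[OF assms that] preimage openin_subset[OF that] topspace_eq by simp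
  qed
  ultimately show ?thesis
    unfolding bihomeomorphic_def bicontinuous_map_def L.topspace_d_spectrum using pos neg inv inv' by blast
qed

end

text \<open>A quantifier over d-lattices has to fix the type of their elements. The equivalence uses
  the type of pairs of subsets of the space, where the d-lattice of compact open sets lives; the
  second conjunct gives the converse for d-lattices over an arbitrary type.\<close>

theorem theorem5p11:
  fixes X :: "'a bitop"
  assumes "bitopological_space X"
  shows "(d_spectral X \<longleftrightarrow>
            (\<exists>L :: ('a set \<times> 'a set) dlattice. d_lattice L \<and> bihomeomorphic X (d_spectrum L))) \<and>
         (\<forall>L :: 'b dlattice. d_lattice L \<and> bihomeomorphic X (d_spectrum L) \<longrightarrow> d_spectral X)"
proof (intro conjI iffI allI impI)
  have top: "topspace (fst X) = topspace (snd X)"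
    using assms by (simp add: bitopological_space_def)
  show "d_spectral X" if "d_lattice L \<and> bihomeomorphic X (d_spectrum L)" for L :: "'b dlattice"
    using that d_spectral_bihomeomorphic[OF top] d_lattice.d_spectral_d_spectrum by blast
  show "d_spectral X"
    if "\<exists>L :: ('a set \<times> 'a set) dlattice. d_lattice L \<and> bihomeomorphic X (d_spectrum L)"
    using that d_spectral_bihomeomorphic[OF top] d_lattice.d_spectral_d_spectrum by blast
  assume X: "d_spectral X"
  then interpret coherent_bitopology X
    by unfold_locales (simp_all add: d_spectral_def top coherent_frame_opens_iff)
  show "\<exists>L :: ('a set \<times> 'a set) dlattice. d_lattice L \<and> bihomeomorphic X (d_spectrum L)"
    using X d_lattice_L bihomeomorphic_d_spectrum by (auto simp: d_spectral_def)
qed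

end
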